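(* There exist a randomized online paging algorithm and an absolute constant $c>0$ such that, for every paging instance (pages $[n]$, cache size $k<n$, request sequence $\sigma\in[n]^T$) and every collection of $M$ NAT predictors, when the algorithm has full information access to the $M$ predictors its expected cost satisfies $$\mathbb{E}[\operatorname{cost}(\mathtt{Alg})]-\mathtt{OPT}\le c\left(\eta^{\min}+k+\sqrt{Tk\log M}\right),$$ where $\eta^{\min}=\min_{j\in[M]}\eta^j$ and $\eta^j=|\{t\in[T]:p^j_t\neq A_t(\sigma_t)\}|$.
   Context: Paging: $n$ pages, cache of exactly $k<n$ pages, request sequence $\sigma=(\sigma_t)_{t\in[T]}\in[n]^T$ revealed online; a cache miss at round $t$ occurs when $\sigma_t$ is not in the cache, and then some cached page must be evicted to bring in $\sigma_t$; the cost is the number of cache misses. With virtual requests $\sigma_{T+i}=i$ ($i\in[n]$), the next arrival time is $A_t(i)=\min\{t'>t:\sigma_{t'}=i\}$. $\mathtt{OPT}$ is the cost of the optimal offline algorithm (furthest in the future, evicting the cached page maximizing $A_t(i)$). A NAT predictor $j\in[M]$ produces in each round $t$ a prediction $p^j_t\in(t,T+n]$ for $A_t(\sigma_t)$. Full information access: in each round $t$ the algorithm receives $p^j_t$ for all $j\in[M]$; if the algorithm must evict in round $t$, the eviction decision is made before receiving the round-$t$ predictions. The algorithm does not know which predictor is best nor the values $\eta^j$. *)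

theory Defs
  imports "HOL-Probability.Probability"
begin

type_synonym page = nat

text \<open>
  Rounds are \<open>1, \<dots>, T\<close> and pages are \<open>1, \<dots>, n\<close>; a request sequence is a function of the round,
  of which only the values on \<open>{1..T}\<close> are meaningful. A cache schedule \<open>C\<close> gives the cache
  content \<open>C t\<close> at the end of round \<open>t\<close>, with \<open>C 0\<close> the initial content.
\<close>

definition paging_instance :: "nat \<Rightarrow> nat \<Rightarrow> nat \<Rightarrow> page set \<Rightarrow> (nat \<Rightarrow> page) \<Rightarrow> bool" where
  "paging_instance n k T C0 \<sigma> \<longleftrightarrow>
     1 \<le> k \<and> k < n \<and> C0 \<subseteq> {1..n} \<and> card C0 = k \<and> (\<forall>t\<in>{1..T}. \<sigma> t \<in> {1..n})"

definition serve :: "page set \<Rightarrow> page \<Rightarrow> page \<Rightarrow> page set" where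
  "serve C x e = (if x \<in> C then C else insert x (C - {e}))"

definition misses :: "nat \<Rightarrow> (nat \<Rightarrow> page) \<Rightarrow> (nat \<Rightarrow> page set) \<Rightarrow> nat" where
  "misses T \<sigma> C = card {t \<in> {1..T}. \<sigma> t \<notin> C (t - 1)}"

definition feasible_schedule :: "nat \<Rightarrow> page set \<Rightarrow> (nat \<Rightarrow> page) \<Rightarrow> (nat \<Rightarrow> page set) \<Rightarrow> bool" where
  "feasible_schedule T C0 \<sigma> C \<longleftrightarrow>
     C 0 = C0 \<and> (\<forall>t\<in>{1..T}. \<exists>e\<in>C (t - 1). C t = serve (C (t - 1)) (\<sigma> t) e)"

definition OPT :: "nat \<Rightarrow> page set \<Rightarrow> (nat \<Rightarrow> page) \<Rightarrow> nat" where
  "OPT T C0 \<sigma> = (INF C \<in> {C. feasible_schedule T C0 \<sigma> C}. misses T \<sigma> C)"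

text \<open>The virtual requests after round \<open>T\<close> are \<open>\<sigma> (T + i) = i\<close> for \<open>i \<in> {1..n}\<close>.\<close>

definition next_arrival :: "nat \<Rightarrow> (nat \<Rightarrow> page) \<Rightarrow> nat \<Rightarrow> page \<Rightarrow> nat" where
  "next_arrival T \<sigma> t i = (LEAST t'. t < t' \<and> (if t' \<le> T then \<sigma> t' else t' - T) = i)"

text \<open>\<open>p j t\<close> is the prediction of predictor \<open>j\<close> in round \<open>t\<close> for \<open>next_arrival T \<sigma> t (\<sigma> t)\<close>.\<close>

definition nat_predictors :: "nat \<Rightarrow> nat \<Rightarrow> nat \<Rightarrow> (nat \<Rightarrow> nat \<Rightarrow> nat) \<Rightarrow> bool" where
  "nat_predictors n T M p \<longleftrightarrow> (\<forall>j\<in>{1..M}. \<forall>t\<in>{1..T}. p j t \<in> {t<..T + n})"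

definition pred_errors :: "nat \<Rightarrow> (nat \<Rightarrow> page) \<Rightarrow> (nat \<Rightarrow> nat) \<Rightarrow> nat" where
  "pred_errors T \<sigma> q = card {t \<in> {1..T}. q t \<noteq> next_arrival T \<sigma> t (\<sigma> t)}"

definition min_pred_errors :: "nat \<Rightarrow> (nat \<Rightarrow> page) \<Rightarrow> nat \<Rightarrow> (nat \<Rightarrow> nat \<Rightarrow> nat) \<Rightarrow> nat" where
  "min_pred_errors T \<sigma> M p = Min ((\<lambda>j. pred_errors T \<sigma> (p j)) ` {1..M})"

text \<open>
  What an online algorithm knows when it acts in round \<open>t\<close>: the parameters \<open>n\<close>, \<open>k\<close>, \<open>M\<close> (but not
  the horizon \<open>T\<close>), the requests of rounds \<open>1, \<dots>, t\<close>, the predictions of all \<open>M\<close> predictors in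
  rounds \<open>1, \<dots>, t - 1\<close>, its own caches at the end of rounds \<open>0, \<dots>, t - 1\<close>, and the outcomes of
  its private random draws in rounds \<open>1, \<dots>, t - 1\<close>.
\<close>

record view =
  num_pages :: nat
  cache_size :: nat
  num_predictors :: nat
  requests :: "page list"
  predictions :: "nat list list"
  caches :: "page set list"
  draws :: "nat list"

text \<open>
  In every round a randomized algorithm randomly chooses a page to evict, which takes effect only
  if there is a cache miss, together with a natural number that it remembers. The latter makes
  correlated random choices across rounds possible, that is, any private random memory.
\<close>

type_synonym rand_alg = "view \<Rightarrow> (page \<times> nat) pmf"

definition rand_paging_alg :: "rand_alg \<Rightarrow> bool" where
  "rand_paging_alg A \<longleftrightarrow>
     (\<forall>v. last (requests v) \<notin> last (caches v) \<and> last (caches v) \<noteq> {} \<longrightarrow>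
        (\<forall>(e, r)\<in>set_pmf (A v). e \<in> last (caches v)))"

definition view_at ::
  "nat \<Rightarrow> nat \<Rightarrow> nat \<Rightarrow> (nat \<Rightarrow> page) \<Rightarrow> (nat \<Rightarrow> nat \<Rightarrow> nat) \<Rightarrow> nat \<Rightarrow> page set list \<Rightarrow> nat list \<Rightarrow> view"
where
  "view_at n k M \<sigma> p t Cs rs =
     \<lparr> num_pages = n, cache_size = k, num_predictors = M,
       requests = map \<sigma> [1..<t + 1],
       predictions = map (\<lambda>s. map (\<lambda>j. p j s) [1..<M + 1]) [1..<t],
       caches = Cs, draws = rs \<rparr>"

text \<open>Joint distribution of the caches and of the private draws after the given number of rounds.\<close>

primrec run ::
  "rand_alg \<Rightarrow> nat \<Rightarrow> nat \<Rightarrow> nat \<Rightarrow> page set \<Rightarrow> (nat \<Rightarrow> page) \<Rightarrow> (nat \<Rightarrow> nat \<Rightarrow> nat) \<Rightarrow> nat \<Rightarrow>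
     (page set list \<times> nat list) pmf"
where
  "run A n k M C0 \<sigma> p 0 = return_pmf ([C0], [])"
| "run A n k M C0 \<sigma> p (Suc t) =
     do {
       (Cs, rs) \<leftarrow> run A n k M C0 \<sigma> p t;
       (e, r) \<leftarrow> A (view_at n k M \<sigma> p (Suc t) Cs rs);
       return_pmf (Cs @ [serve (last Cs) (\<sigma> (Suc t)) e], rs @ [r])
     }"

definition expected_cost ::
  "rand_alg \<Rightarrow> nat \<Rightarrow> nat \<Rightarrow> nat \<Rightarrow> nat \<Rightarrow> page set \<Rightarrow> (nat \<Rightarrow> page) \<Rightarrow> (nat \<Rightarrow> nat \<Rightarrow> nat) \<Rightarrow> real"
where
  "expected_cost A n k M T C0 \<sigma> p =
     measure_pmf.expectation (run A n k M C0 \<sigma> p T) (\<lambda>(Cs, rs). real (misses T \<sigma> ((!) Cs)))"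

end

theory Submission
  imports Defs
begin

text \<open>
  A prediction \<open>q u\<close> made in round \<open>u\<close> is read as an interval \<open>(u, q u)\<close>. A page hit amounts to
  holding such an interval for its whole length, so offline paging is the problem of choosing as
  many intervals as possible with at most \<open>k - 1\<close> of them over any round. Every predictor yields an
  expert that runs furthest-in-the-future greedily on its own predicted intervals; greedy is optimal
  for these, and each wrong prediction changes one interval, so the expert misses at most
  \<open>OPT + k + 2 \<eta>\<close> times.

  The algorithm lazily imitates the cache of one expert, which costs the misses of the imitated
  experts plus \<open>k\<close> per switch. The expert is drawn according to Hedge with learning rate
  \<open>sqrt (ln M / (k t))\<close>, correlated over time as in the shrinking dartboard algorithm so that the
  probability of a switch is of the order of the learning rate.
\<close>

section \<open>Greedy scheduling of predicted intervals\<close>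

text \<open>
  \<open>greedy k q t\<close> is the set of rounds \<open>u \<le> t\<close> whose interval \<open>(u, q u)\<close> has not been given up by the
  end of round \<open>t\<close>; completed intervals stay in it. It depends only on the predictions before round
  \<open>t\<close>.
\<close>

primrec greedy :: "nat \<Rightarrow> (nat \<Rightarrow> nat) \<Rightarrow> nat \<Rightarrow> nat set" where
  "greedy k q 0 = {}"
| "greedy k q (Suc t) = insert (Suc t)
     (let L = {u \<in> greedy k q t. Suc t < q u}
      in if card L < k then greedy k q t
         else greedy k q t - {SOME u. u \<in> L \<and> (\<forall>v\<in>L. q v \<le> q u)})"

text \<open>The disjunct \<open>u = t\<close> keeps the page just requested whatever
  \<open>q t\<close> is, and makes the cache at the end of round \<open>t\<close> independent of the
  prediction of that round. The expert starts from an empty cache instead of the initial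
  one.\<close>

definition expert_cache :: "nat \<Rightarrow> (nat \<Rightarrow> page) \<Rightarrow> (nat \<Rightarrow> nat) \<Rightarrow> nat \<Rightarrow> page set" where
  "expert_cache k \<sigma> q t = \<sigma> ` {u \<in> greedy k q t. u = t \<or> t < q u}"

lemma greedy_Suc_subset: "greedy k q (Suc t) \<subseteq> insert (Suc t) (greedy k q t)"
  by (auto simp: Let_def)

lemma greedy_subset: "greedy k q t \<subseteq> {1..t}"
proof (induction t)
  case (Suc t)
  then show ?case using greedy_Suc_subset[of k q t] by force
qed simp

lemma finite_greedy: "finite (greedy k q t)"
  by (rule finite_subset[OF greedy_subset]) simp

lemma greedy_antimono:
  assumes "u \<in> greedy k q t" "u \<le> s" "s \<le> t"
  shows "u \<in> greedy k q s"
  using assms(3,1,2)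
proof (induction t rule: dec_induct)
  case (step t)
  then show ?case using greedy_Suc_subset[of k q t] by auto
qed simp

lemma greedy_cong:
  assumes "\<And>u. u \<in> {1..<t} \<Longrightarrow> q u = q' u"
  shows "greedy k q t = greedy k q' t"
  using assms
proof (induction t)
  case (Suc t)
  have IH: "greedy k q t = greedy k q' t"
    using Suc by simp
  have eq: "q u = q' u" if "u \<in> greedy k q' t" for u
    using that greedy_subset[of k q' t] Suc.prems by force
  define L where "L = {u \<in> greedy k q' t. Suc t < q' u}"
  have L: "{u \<in> greedy k q t. Suc t < q u} = L"
    unfolding L_def IH using eq by auto
  have eqL: "q u = q' u" if "u \<in> L" for u
    using that eq by (simp add: L_def)
  have some_eq: "(SOME u. u \<in> L \<and> (\<forall>v\<in>L. q v \<le> q u)) = (SOME u. u \<in> L \<and> (\<forall>v\<in>L. q' v \<le> q' u))"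
    by (rule arg_cong[where f = Eps]) (use eqL in auto)
  show ?case
    unfolding greedy.simps L unfolding L_def[symmetric] Let_def some_eq IH by simp
qed simp

text \<open>This makes the experts available online: in round \<open>t\<close> the view holds the
  requests up to \<open>t\<close> but only the predictions before \<open>t\<close>.\<close>

lemma expert_cache_cong:
  assumes "\<And>u. u \<in> {1..t} \<Longrightarrow> \<sigma> u = \<sigma>' u" "\<And>u. u \<in> {1..<t} \<Longrightarrow> q u = q' u"
  shows "expert_cache k \<sigma> q t = expert_cache k \<sigma>' q' t"
proof -
  have "greedy k q t = greedy k q' t"
    by (rule greedy_cong) (rule assms(2))
  moreover have "(u = t \<or> t < q u) = (u = t \<or> t < q' u)" if "u \<in> greedy k q' t" for u
    using that assms(2)[of u] greedy_subset[of k q' t] by (cases "u = t") auto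
  ultimately have "{u \<in> greedy k q t. u = t \<or> t < q u} = {u \<in> greedy k q' t. u = t \<or> t < q' u}"
    by blast
  then show ?thesis
    unfolding expert_cache_def by (intro image_cong) (use assms(1) greedy_subset[of k q' t] in auto)
qed

lemma expert_cache_0 [simp]: "expert_cache k \<sigma> q 0 = {}"
  by (simp add: expert_cache_def)

lemma finite_expert_cache: "finite (expert_cache k \<sigma> q t)"
  by (simp add: expert_cache_def finite_greedy)

lemma requested_in_expert_cache: "t \<ge> 1 \<Longrightarrow> \<sigma> t \<in> expert_cache k \<sigma> q t"
  by (cases t) (auto simp: expert_cache_def Let_def)

lemma expert_cache_Suc_subset:
  "expert_cache k \<sigma> q (Suc t) \<subseteq> insert (\<sigma> (Suc t)) (expert_cache k \<sigma> q t)"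
  unfolding expert_cache_def using greedy_Suc_subset[of k q t] by force

text \<open>Since \<open>1 \<le> k\<close>, a set \<open>L\<close> of cardinality at least
  \<open>k\<close> is finite and nonempty, so the \<open>SOME\<close> in \<open>greedy\<close> picks
  a true maximiser of \<open>q\<close>.\<close>

lemma greedy_drop:
  assumes "L = {u \<in> greedy k q t. Suc t < q u}" "\<not> card L < k" "1 \<le> k"
  obtains x where "x \<in> L" "\<And>v. v \<in> L \<Longrightarrow> q v \<le> q x"
    "greedy k q (Suc t) = insert (Suc t) (greedy k q t - {x})"
proof -
  have fin: "finite L" by (simp add: assms(1) finite_greedy)
  have "L \<noteq> {}" using assms(2,3) by auto
  then have "Max (q ` L) \<in> q ` L" using fin by simp
  then obtain u where "u \<in> L" "q u = Max (q ` L)" by auto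
  then have "\<exists>u. u \<in> L \<and> (\<forall>v\<in>L. q v \<le> q u)"
    using fin by (intro exI[of _ u]) auto
  then have "(SOME u. u \<in> L \<and> (\<forall>v\<in>L. q v \<le> q u)) \<in> L \<and>
      (\<forall>v\<in>L. q v \<le> q (SOME u. u \<in> L \<and> (\<forall>v\<in>L. q v \<le> q u)))"
    by (rule someI_ex)
  then show ?thesis
    by (intro that[of "SOME u. u \<in> L \<and> (\<forall>v\<in>L. q v \<le> q u)"])
      (use assms(1,2) in \<open>auto simp: Let_def\<close>)
qed

text \<open>The induction counts live intervals rather than pages, as wrong predictions can leave
  two live intervals for one page. The intervals that survive into the next round form
  \<open>L\<close>; if there are already \<open>k\<close> of them, one is dropped to make room for
  the new one.\<close>

lemma card_expert_cache:
  assumes "1 \<le> k"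
  shows "card (expert_cache k \<sigma> q t) \<le> k"
proof -
  have "card {u \<in> greedy k q t. u = t \<or> t < q u} \<le> k"
  proof (induction t)
    case (Suc t)
    define L where "L = {u \<in> greedy k q t. Suc t < q u}"
    have fin: "finite L" by (simp add: L_def finite_greedy)
    have "card L \<le> card {u \<in> greedy k q t. u = t \<or> t < q u}"
      by (rule card_mono) (auto simp: L_def finite_greedy)
    then have Lk: "card L \<le> k" using Suc by simp
    show ?case
    proof (cases "card L < k")
      case True
      have "{u \<in> greedy k q (Suc t). u = Suc t \<or> Suc t < q u} \<subseteq> insert (Suc t) L"
        using greedy_Suc_subset[of k q t] by (auto simp: L_def)
      then have "card {u \<in> greedy k q (Suc t). u = Suc t \<or> Suc t < q u} \<le> card (insert (Suc t) L)"
        using fin by (intro card_mono) auto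
      also have "\<dots> \<le> k" using True fin by (simp add: card_insert_if)
      finally show ?thesis .
    next
      case False
      obtain x where x: "x \<in> L" "greedy k q (Suc t) = insert (Suc t) (greedy k q t - {x})"
        using greedy_drop[OF L_def False assms] by metis
      have "{u \<in> greedy k q (Suc t). u = Suc t \<or> Suc t < q u} \<subseteq> insert (Suc t) (L - {x})"
        unfolding x(2) by (auto simp: L_def)
      then have "card {u \<in> greedy k q (Suc t). u = Suc t \<or> Suc t < q u}
          \<le> card (insert (Suc t) (L - {x}))"
        using fin by (intro card_mono) auto
      also have "\<dots> \<le> Suc (card (L - {x}))"
        using fin by (simp add: card_insert_if)
      also have "\<dots> = card L" using x(1) fin by (simp add: card_Suc_Diff1 del: card_Diff_insert)
      finally show ?thesis using Lk by simp
    qed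
  qed simp
  then show ?thesis
    unfolding expert_cache_def using card_image_le[of "{u \<in> greedy k q t. u = t \<or> t < q u}" \<sigma>]
    by (simp add: finite_greedy)
qed

text \<open>
  Greedy stays ahead for every deadline \<open>s\<close> simultaneously: an eviction with furthest deadline
  only affects deadlines past all live intervals, where the capacity bound on \<open>X\<close> takes over.
\<close>

lemma greedy_stays_ahead:
  assumes k: "1 \<le> k" and X: "finite X" "0 \<notin> X"
    and cap: "\<And>t. t \<in> {1..T} \<Longrightarrow> card {u \<in> X. u < t \<and> t < q u} < k"
    and "t \<le> T" "t \<le> s"
  shows "card {u \<in> X. u \<le> t \<and> q u \<le> s} \<le> card {u \<in> greedy k q t. q u \<le> s}"
  using assms(5,6)
proof (induction t arbitrary: s)
  case 0
  then have "{u \<in> X. u \<le> 0 \<and> q u \<le> s} = {}" using X by auto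
  then show ?case by simp
next
  case (Suc t)
  let ?X = "\<lambda>t s. {u \<in> X. u \<le> t \<and> q u \<le> s}"
  let ?G = "\<lambda>s. {u \<in> greedy k q t. q u \<le> s}"
  have notin: "Suc t \<notin> greedy k q t" using greedy_subset[of k q t] by auto
  have IH: "card (?X t s') \<le> card (?G s')" if "t \<le> s'" for s'
    using Suc that by simp
  define L where "L = {u \<in> greedy k q t. Suc t < q u}"
  have finL: "finite L" by (simp add: L_def finite_greedy)
  obtain R where R: "greedy k q (Suc t) = insert (Suc t) R" "R \<subseteq> greedy k q t"
    and le: "card (?X t s) \<le> card {u \<in> R. q u \<le> s}"
  proof (cases "card L < k")
    case True
    show ?thesis
      by (rule that[of "greedy k q t"])
        (use True IH[of s] Suc.prems in \<open>auto simp: L_def[symmetric]\<close>)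
  next
    case False
    obtain x where x: "x \<in> L" "\<And>v. v \<in> L \<Longrightarrow> q v \<le> q x"
      "greedy k q (Suc t) = insert (Suc t) (greedy k q t - {x})"
      using greedy_drop[OF L_def False k] by blast
    have "card (?X t s) \<le> card {u \<in> greedy k q t - {x}. q u \<le> s}"
    proof (cases "q x \<le> s")
      case False
      then have "{u \<in> greedy k q t - {x}. q u \<le> s} = ?G s" by auto
      then show ?thesis using IH[of s] Suc.prems by simp
    next
      case True
      \<comment> \<open>An interval of \<open>X\<close> with deadline at most \<open>s\<close>
        either ends by \<open>Suc t\<close>, where the induction hypothesis applies, or covers round
        \<open>Suc t\<close>, which \<open>cap\<close> allows for at most \<open>k - 1\<close> of
        them. The latter are matched by \<open>L - {x}\<close>, which has at least
        \<open>k - 1\<close> elements, all with deadline at most \<open>q x \<le> s\<close>.\<close>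
      have "?X t s \<subseteq> ?X t (Suc t) \<union> {u \<in> X. u < Suc t \<and> Suc t < q u}" by auto
      then have "card (?X t s) \<le> card (?X t (Suc t) \<union> {u \<in> X. u < Suc t \<and> Suc t < q u})"
        using X by (intro card_mono) auto
      also have "\<dots> \<le> card (?X t (Suc t)) + card {u \<in> X. u < Suc t \<and> Suc t < q u}"
        by (rule card_Un_le)
      also have "\<dots> \<le> card (?G (Suc t)) + (k - 1)"
        using IH[of "Suc t"] cap[of "Suc t"] Suc.prems by simp
      also have "\<dots> \<le> card (?G (Suc t)) + card (L - {x})"
        using False x(1) finL by simp
      also have "\<dots> = card (?G (Suc t) \<union> (L - {x}))"
        by (rule card_Un_disjoint[symmetric]) (auto simp: finite_greedy finL L_def)
      also have "\<dots> \<le> card {u \<in> greedy k q t - {x}. q u \<le> s}"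
      proof (rule card_mono)
        show "?G (Suc t) \<union> (L - {x}) \<subseteq> {u \<in> greedy k q t - {x}. q u \<le> s}"
          using x True Suc.prems by (fastforce simp: L_def)
      qed (simp add: finite_greedy)
      finally show ?thesis .
    qed
    then show ?thesis using that[of "greedy k q t - {x}"] x by blast
  qed
  have finR: "finite {u \<in> R. q u \<le> s}"
    using R(2) finite_greedy[of k q t] by (simp add: finite_subset)
  show ?case
  proof (cases "q (Suc t) \<le> s")
    case True
    have "?X (Suc t) s \<subseteq> insert (Suc t) (?X t s)" by (auto simp: le_Suc_eq)
    then have "card (?X (Suc t) s) \<le> card (insert (Suc t) (?X t s))"
      using X by (intro card_mono) auto
    also have "\<dots> \<le> Suc (card (?X t s))" using X by (simp add: card_insert_if)
    also have "\<dots> \<le> Suc (card {u \<in> R. q u \<le> s})" using le by simp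
    also have "\<dots> = card (insert (Suc t) {u \<in> R. q u \<le> s})"
      using finR R notin by (subst card_insert_disjoint) auto
    also have "insert (Suc t) {u \<in> R. q u \<le> s} = {u \<in> greedy k q (Suc t). q u \<le> s}"
      using True unfolding R by auto
    finally show ?thesis .
  next
    case False
    then have "?X (Suc t) s = ?X t s" by (auto simp: le_Suc_eq)
    moreover have "{u \<in> greedy k q (Suc t). q u \<le> s} = {u \<in> R. q u \<le> s}"
      using False unfolding R by auto
    ultimately show ?thesis using le by simp
  qed
qed

section \<open>Schedules as sets of served intervals\<close>

text \<open>The virtual request of \<open>\<sigma> u\<close> in round \<open>T + \<sigma> u\<close>
  shows that the minimum is taken over a nonempty set.\<close>

lemma next_arrival_gt:
  assumes "\<sigma> u \<in> {1..n}" "u \<le> T"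
  shows "u < next_arrival T \<sigma> u (\<sigma> u)"
    and "next_arrival T \<sigma> u (\<sigma> u) \<le> T \<Longrightarrow> \<sigma> (next_arrival T \<sigma> u (\<sigma> u)) = \<sigma> u"
proof -
  let ?P = "\<lambda>t'. u < t' \<and> (if t' \<le> T then \<sigma> t' else t' - T) = \<sigma> u"
  have "?P (T + \<sigma> u)" using assms by auto
  then have "?P (next_arrival T \<sigma> u (\<sigma> u))"
    unfolding next_arrival_def by (rule LeastI)
  then show "u < next_arrival T \<sigma> u (\<sigma> u)"
    "next_arrival T \<sigma> u (\<sigma> u) \<le> T \<Longrightarrow> \<sigma> (next_arrival T \<sigma> u (\<sigma> u)) = \<sigma> u"
    by auto
qed

lemma next_arrival_le:
  "u < v \<Longrightarrow> v \<le> T \<Longrightarrow> \<sigma> v = i \<Longrightarrow> next_arrival T \<sigma> u i \<le> v"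
  unfolding next_arrival_def by (rule Least_le) simp

lemma next_arrival_eqI:
  assumes "u < t" "t \<le> T" "\<sigma> t = i" "\<And>v. u < v \<Longrightarrow> v < t \<Longrightarrow> \<sigma> v \<noteq> i"
  shows "next_arrival T \<sigma> u i = t"
  unfolding next_arrival_def
  by (rule Least_equality) (use assms in \<open>auto simp: not_le[symmetric] split: if_splits\<close>)

text \<open>Two rounds with the same real next arrival request the same page; but then the later
  round is itself an arrival after the earlier one, and it comes sooner.\<close>

lemma inj_on_next_arrival:
  assumes "\<And>u. u \<in> {1..T} \<Longrightarrow> \<sigma> u \<in> {1..n}"
    and "\<And>u. u \<in> U \<Longrightarrow> u \<in> {1..T} \<and> next_arrival T \<sigma> u (\<sigma> u) \<le> T"
  shows "inj_on (\<lambda>u. next_arrival T \<sigma> u (\<sigma> u)) U"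
proof (rule linorder_inj_onI')
  fix u v assume uv: "u \<in> U" "v \<in> U" "u < v"
  show "next_arrival T \<sigma> u (\<sigma> u) \<noteq> next_arrival T \<sigma> v (\<sigma> v)"
  proof
    assume eq: "next_arrival T \<sigma> u (\<sigma> u) = next_arrival T \<sigma> v (\<sigma> v)"
    then have "\<sigma> u = \<sigma> v"
      using next_arrival_gt(2)[of \<sigma> u n T] next_arrival_gt(2)[of \<sigma> v n T] assms uv
      by (metis atLeastAtMost_iff)
    then have "next_arrival T \<sigma> u (\<sigma> u) \<le> v"
      using uv assms by (intro next_arrival_le) auto
    moreover have "v < next_arrival T \<sigma> v (\<sigma> v)"
      using uv assms by (intro next_arrival_gt) auto
    ultimately show False using eq by simp
  qed
qed

lemma feasible_SucE:
  assumes "feasible_schedule T C0 \<sigma> C" "t < T"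
  obtains e where "e \<in> C t" "C (Suc t) = serve (C t) (\<sigma> (Suc t)) e"
proof -
  have "\<exists>e\<in>C (Suc t - 1). C (Suc t) = serve (C (Suc t - 1)) (\<sigma> (Suc t)) e"
    by (rule bspec[of "{1..T}"]) (use assms in \<open>auto simp: feasible_schedule_def\<close>)
  then show ?thesis using that by auto
qed

lemma feasible_card:
  assumes "feasible_schedule T C0 \<sigma> C" "finite C0" "card C0 = k" "t \<le> T"
  shows "finite (C t) \<and> card (C t) = k"
  using assms(4)
proof (induction t)
  case 0
  then show ?case using assms by (simp add: feasible_schedule_def)
next
  case (Suc t)
  then obtain e where e: "e \<in> C t" "C (Suc t) = serve (C t) (\<sigma> (Suc t)) e"
    using feasible_SucE[OF assms(1), of t] by auto
  have "0 < card (C t)" using e Suc by (metis Suc_leD card_gt_0_iff empty_iff)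
  then show ?case using e Suc by (auto simp: serve_def)
qed

lemma feasible_requested_in:
  assumes "feasible_schedule T C0 \<sigma> C" "t \<in> {1..T}"
  shows "\<sigma> t \<in> C t"
proof -
  obtain s where s: "t = Suc s" "s < T" using assms(2) by (cases t) auto
  then show ?thesis using feasible_SucE[OF assms(1), of s] by (metis insertI1 serve_def)
qed

text \<open>Only a request brings a page into the cache, so membership can be traced back in time
  until the last request of the page.\<close>

lemma feasible_stays:
  assumes "feasible_schedule T C0 \<sigma> C" "u \<le> v" "v \<le> T" "x \<in> C v"
    and "\<And>w. u < w \<Longrightarrow> w \<le> v \<Longrightarrow> \<sigma> w \<noteq> x"
  shows "x \<in> C u"
  using assms(2-5)
proof (induction v rule: dec_induct)
  case (step v)
  then obtain e where "C (Suc v) = serve (C v) (\<sigma> (Suc v)) e"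
    using feasible_SucE[OF assms(1), of v] by (metis Suc_le_lessD)
  moreover have "\<sigma> (Suc v) \<noteq> x" using step by simp
  ultimately have "x \<in> C v" using step.prems by (auto simp: serve_def split: if_splits)
  then show ?case using step by simp
qed

text \<open>A hit on a page requested before is the next arrival of the last earlier request
  \<open>u\<close> of that page, and the page was held ever since \<open>u\<close>. The remaining
  hits, collected in \<open>?A\<close>, are on pairwise distinct pages of the initial cache, which
  accounts for the term \<open>k\<close>.\<close>

lemma feasible_hits_le:
  assumes feas: "feasible_schedule T C0 \<sigma> C" and C0: "finite C0" "card C0 = k"
    and \<sigma>: "\<And>u. u \<in> {1..T} \<Longrightarrow> \<sigma> u \<in> {1..n}"
  defines "na \<equiv> \<lambda>u. next_arrival T \<sigma> u (\<sigma> u)"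
  shows "card {t \<in> {1..T}. \<sigma> t \<in> C (t - 1)}
    \<le> k + card {u \<in> {1..T}. na u \<le> T \<and> (\<forall>v. u \<le> v \<and> v < na u \<longrightarrow> \<sigma> u \<in> C v)}"
    (is "card ?H \<le> k + card ?X")
proof -
  let ?A = "{t \<in> ?H. \<forall>u\<in>{1..<t}. \<sigma> u \<noteq> \<sigma> t}"
  have "card ?A \<le> card C0"
  proof (rule card_inj_on_le)
    show "inj_on \<sigma> ?A"
      by (rule linorder_inj_onI') auto
    show "\<sigma> ` ?A \<subseteq> C0"
    proof clarify
      fix t assume t: "t \<in> {1..T}" "\<sigma> t \<in> C (t - 1)" "\<forall>u\<in>{1..<t}. \<sigma> u \<noteq> \<sigma> t"
      have "\<sigma> t \<in> C 0"
        by (rule feasible_stays[OF feas, of 0 "t - 1"]) (use t in auto)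
      then show "\<sigma> t \<in> C0" using feas by (simp add: feasible_schedule_def)
    qed
  qed (fact C0)
  moreover have "?H - ?A \<subseteq> na ` ?X"
  proof
    fix t assume t: "t \<in> ?H - ?A"
    define U where "U = {u \<in> {1..<t}. \<sigma> u = \<sigma> t}"
    have U: "finite U" "U \<noteq> {}" using t by (auto simp: U_def)
    define u where "u = Max U"
    have uU: "u \<in> U" using U unfolding u_def by (rule Max_in)
    have last: "\<sigma> v \<noteq> \<sigma> u" if "u < v" "v < t" for v
    proof
      assume "\<sigma> v = \<sigma> u"
      then have "v \<in> U" using that uU by (auto simp: U_def)
      then show False using U that by (auto simp: u_def)
    qed
    have na: "na u = t"
      unfolding na_def by (rule next_arrival_eqI) (use t uU last in \<open>auto simp: U_def\<close>)
    have "\<sigma> u \<in> C v" if "u \<le> v" "v < t" for v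
    proof (rule feasible_stays[OF feas, of v "t - 1"])
      show "\<sigma> u \<in> C (t - 1)" using t uU by (auto simp: U_def)
    qed (use that last t in auto)
    then have "u \<in> ?X" using na t uU by (auto simp: U_def)
    then show "t \<in> na ` ?X" using na by blast
  qed
  then have "card (?H - ?A) \<le> card ?X"
    by (intro surj_card_le) auto
  moreover have "card ?H \<le> card ?A + card (?H - ?A)"
    using card_Un_le[of ?A "?H - ?A"] by (simp add: Un_absorb1 Collect_mono subset_iff)
  ultimately show ?thesis using C0 by linarith
qed

lemma misses_eq: "misses T \<sigma> C = T - card {t \<in> {1..T}. \<sigma> t \<in> C (t - 1)}"
proof -
  define H where "H = {t \<in> {1..T}. \<sigma> t \<in> C (t - 1)}"
  have "H \<subseteq> {1..T}" "{t \<in> {1..T}. \<sigma> t \<notin> C (t - 1)} = {1..T} - H" by (auto simp: H_def)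
  then show ?thesis
    unfolding misses_def H_def[symmetric] by (simp add: card_Diff_subset finite_subset)
qed

text \<open>Hits of \<open>C\<close> are turned into served intervals \<open>Y\<close>, these into
  correctly predicted ones \<open>X\<close>, these into intervals completed by greedy, and these
  into hits of the expert. The mispredicted rounds \<open>E\<close> are lost twice: when passing
  from \<open>Y\<close> to \<open>X\<close>, and when completed greedy intervals are read as
  hits.\<close>

lemma expert_misses_le_feasible:
  assumes inst: "paging_instance n k T C0 \<sigma>" and feas: "feasible_schedule T C0 \<sigma> C"
  shows "misses T \<sigma> (expert_cache k \<sigma> q) \<le> misses T \<sigma> C + k + 2 * pred_errors T \<sigma> q"
proof -
  define na where "na = (\<lambda>u. next_arrival T \<sigma> u (\<sigma> u))"
  have k: "1 \<le> k" and C0: "finite C0" "card C0 = k"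
    and \<sigma>: "\<And>u. u \<in> {1..T} \<Longrightarrow> \<sigma> u \<in> {1..n}"
    using inst by (auto simp: paging_instance_def finite_subset)
  define E where "E = {u \<in> {1..T}. q u \<noteq> na u}"
  have E: "card E = pred_errors T \<sigma> q" by (simp add: E_def na_def pred_errors_def)
  define Y where "Y = {u \<in> {1..T}. na u \<le> T \<and> (\<forall>v. u \<le> v \<and> v < na u \<longrightarrow> \<sigma> u \<in> C v)}"
  define X where "X = Y - E"
  define H where "H = (\<lambda>C. {t \<in> {1..T}. \<sigma> t \<in> C (t - 1)})"
  have na: "u < na u" if "u \<in> {1..T}" for u
    unfolding na_def by (rule next_arrival_gt) (use that \<sigma> in auto)
  have "card (H C) \<le> k + card Y"
    using feasible_hits_le[OF feas C0 \<sigma>] unfolding Y_def na_def H_def by simp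
  moreover have "card Y \<le> card X + card E"
    unfolding X_def using diff_card_le_card_Diff[of E Y] by (simp add: E_def)
  moreover have "card X \<le> card {u \<in> greedy k q T. q u \<le> T}"
  proof -
    \<comment> \<open>The pages of the intervals over round \<open>t\<close> are distinct and lie in
      \<open>C t\<close>. None of them is \<open>\<sigma> t\<close>, since a request of the page
      would end its interval; this saves the one slot that makes the inequality strict.\<close>
    have "card {u \<in> X. u < t \<and> t < q u} < k" if t: "t \<in> {1..T}" for t
    proof -
      have q: "q u = na u" if "u \<in> X" for u
        using that by (auto simp: X_def E_def Y_def)
      have "card {u \<in> X. u < t \<and> t < q u} \<le> card (C t - {\<sigma> t})"
      proof (rule card_inj_on_le)
        have first: "na u \<le> v" if "u \<in> X" "u < v" "v \<le> T" "\<sigma> v = \<sigma> u" for u v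
          unfolding na_def using that by (intro next_arrival_le) auto
        show "inj_on \<sigma> {u \<in> X. u < t \<and> t < q u}"
        proof (rule linorder_inj_onI')
          fix u v assume "u \<in> {u \<in> X. u < t \<and> t < q u}" "v \<in> {u \<in> X. u < t \<and> t < q u}" "u < v"
          then show "\<sigma> u \<noteq> \<sigma> v" using first[of u v] q[of u] t by auto
        qed
        show "\<sigma> ` {u \<in> X. u < t \<and> t < q u} \<subseteq> C t - {\<sigma> t}"
        proof clarify
          fix u assume u: "u \<in> X" "u < t" "t < q u"
          then have "\<sigma> u \<in> C t" using q[of u] by (auto simp: X_def Y_def)
          moreover have "\<sigma> u \<noteq> \<sigma> t" using first[of u t] u q[of u] t by auto
          ultimately show "\<sigma> u \<in> C t - {\<sigma> t}" by simp
        qed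
        show "finite (C t - {\<sigma> t})" using feasible_card[OF feas C0, of t] t by simp
      qed
      also have "\<dots> < k"
        using feasible_card[OF feas C0, of t] feasible_requested_in[OF feas t] t k by simp
      finally show ?thesis .
    qed
    moreover have "finite X" "0 \<notin> X" by (auto simp: X_def Y_def)
    ultimately have "card {u \<in> X. u \<le> T \<and> q u \<le> T} \<le> card {u \<in> greedy k q T. q u \<le> T}"
      using greedy_stays_ahead[OF k] by blast
    moreover have "{u \<in> X. u \<le> T \<and> q u \<le> T} = X"
      by (auto simp: X_def Y_def E_def)
    ultimately show ?thesis by simp
  qed
  moreover have "card {u \<in> greedy k q T. q u \<le> T} \<le> card (H (expert_cache k \<sigma> q)) + card E"
  proof -
    let ?Z = "{u \<in> greedy k q T. q u \<le> T} - E"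
    have Z: "u \<in> {1..T} \<and> q u = na u \<and> na u \<le> T" if "u \<in> ?Z" for u
      using that greedy_subset[of k q T] by (auto simp: E_def)
    have "card ?Z \<le> card (H (expert_cache k \<sigma> q))"
    proof (rule card_inj_on_le)
      show "inj_on na ?Z"
        unfolding na_def by (rule inj_on_next_arrival[OF \<sigma>]) (simp, use Z[unfolded na_def] in blast)
      show "na ` ?Z \<subseteq> H (expert_cache k \<sigma> q)"
      proof
        fix t assume "t \<in> na ` ?Z"
        then obtain u where u: "u \<in> ?Z" "t = na u" by blast
        have ut: "u < t" "t \<le> T" "q u = t" using Z[OF u(1)] na u by auto
        have "\<sigma> t = \<sigma> u"
          unfolding u(2) na_def
          using \<sigma> Z[OF u(1), unfolded na_def] by (intro next_arrival_gt) auto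
        \<comment> \<open>An interval never given up up to round \<open>T\<close> was in particular
          kept just before its deadline, so the page is in the expert's cache when it is
          requested.\<close>
        moreover have "u \<in> greedy k q (t - 1)"
          by (rule greedy_antimono[of u k q T]) (use u(1) ut(1,2) in auto)
        then have "\<sigma> u \<in> expert_cache k \<sigma> q (t - 1)"
          unfolding expert_cache_def using ut(1,3) by (intro imageI) auto
        ultimately show "t \<in> H (expert_cache k \<sigma> q)" using ut by (auto simp: H_def)
      qed
    qed (simp add: H_def)
    moreover have "card {u \<in> greedy k q T. q u \<le> T} \<le> card ?Z + card E"
      using diff_card_le_card_Diff[of E "{u \<in> greedy k q T. q u \<le> T}"] by (simp add: E_def)
    ultimately show ?thesis by linarith
  qed
  ultimately have "card (H C) \<le> card (H (expert_cache k \<sigma> q)) + k + 2 * card E"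
    by linarith
  moreover have "card (H C) \<le> T"
    using card_mono[of "{1..T}" "H C"] unfolding H_def by force
  ultimately show ?thesis
    unfolding misses_eq E[symmetric] H_def by linarith
qed

text \<open>An infimum of a nonempty set of natural numbers is attained; the schedule that evicts an
  arbitrary page shows that a feasible one exists.\<close>

lemma OPT_attained:
  assumes "C0 \<noteq> {}"
  obtains C where "feasible_schedule T C0 \<sigma> C" "misses T \<sigma> C = OPT T C0 \<sigma>"
proof -
  define C where "C = rec_nat C0 (\<lambda>t D. serve D (\<sigma> (Suc t)) (SOME e. e \<in> D))"
  have C_Suc: "C (Suc t) = serve (C t) (\<sigma> (Suc t)) (SOME e. e \<in> C t)" for t
    by (simp add: C_def)
  have ne: "C t \<noteq> {}" for t
    by (induction t) (auto simp: C_Suc serve_def, simp add: C_def assms)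
  have "feasible_schedule T C0 \<sigma> C"
    unfolding feasible_schedule_def
  proof (intro conjI ballI)
    fix t assume "t \<in> {1..T}"
    then obtain s where s: "t = Suc s" by (cases t) auto
    show "\<exists>e\<in>C (t - 1). C t = serve (C (t - 1)) (\<sigma> t) e"
      using C_Suc[of s] ne[of s] some_in_eq[of "C s"] unfolding s by auto
  qed (simp add: C_def)
  then have "OPT T C0 \<sigma> \<in> misses T \<sigma> ` {C. feasible_schedule T C0 \<sigma> C}"
    unfolding OPT_def by (intro Inf_nat_def1) auto
  then show ?thesis using that by auto
qed

section \<open>Hedge with a decreasing learning rate\<close>

text \<open>The Gibbs distribution on the experts; \<open>x j\<close> is a cumulative loss already
  multiplied by the learning rate.\<close>

definition hedge_pmf :: "nat \<Rightarrow> (nat \<Rightarrow> real) \<Rightarrow> nat pmf" where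
  "hedge_pmf M x = embed_pmf (\<lambda>j. if j \<in> {1..M} then exp (- x j) / (\<Sum>i=1..M. exp (- x i)) else 0)"

lemma hedge_norm_pos: "M \<ge> 1 \<Longrightarrow> 0 < (\<Sum>i=1..M::nat. exp (- x i :: real))"
  by (rule sum_pos) auto

lemma pmf_hedge_pmf:
  assumes "M \<ge> 1"
  shows "pmf (hedge_pmf M x) j =
    (if j \<in> {1..M} then exp (- x j) / (\<Sum>i=1..M. exp (- x i)) else 0)"
proof -
  let ?W = "\<Sum>i=1..M. exp (- x i)"
  have W: "0 < ?W" by (rule hedge_norm_pos[OF assms])
  have "(\<integral>\<^sup>+ j. ennreal (if j \<in> {1..M} then exp (- x j) / ?W else 0) \<partial>count_space UNIV)
      = (\<integral>\<^sup>+ j. ennreal (exp (- x j) / ?W) * indicator {1..M} j \<partial>count_space UNIV)"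
    by (intro nn_integral_cong) (auto simp: indicator_def)
  also have "\<dots> = (\<integral>\<^sup>+ j. ennreal (exp (- x j) / ?W) \<partial>count_space {1..M})"
    by (simp add: nn_integral_count_space_indicator)
  also have "\<dots> = (\<Sum>j=1..M. ennreal (exp (- x j) / ?W))"
    by (simp add: nn_integral_count_space_finite)
  also have "\<dots> = ennreal (\<Sum>j=1..M. exp (- x j) / ?W)"
    using W by (intro sum_ennreal) simp
  also have "(\<Sum>j=1..M. exp (- x j) / ?W) = 1"
    using W by (simp add: sum_divide_distrib[symmetric])
  finally have "(\<integral>\<^sup>+ j. ennreal (if j \<in> {1..M} then exp (- x j) / ?W else 0) \<partial>count_space UNIV) = 1"
    by simp
  then show ?thesis
    unfolding hedge_pmf_def using W by (intro pmf_embed_pmf) auto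
qed

lemma set_hedge_pmf: "M \<ge> 1 \<Longrightarrow> set_pmf (hedge_pmf M x) = {1..M}"
  using hedge_norm_pos[of M x] by (auto simp: set_pmf_eq pmf_hedge_pmf)

lemma expectation_hedge_pmf:
  fixes f :: "nat \<Rightarrow> real"
  assumes "M \<ge> 1"
  shows "measure_pmf.expectation (hedge_pmf M x) f =
    (\<Sum>j=1..M. exp (- x j) * f j) / (\<Sum>i=1..M. exp (- x i))"
  by (subst integral_measure_pmf_real[of "{1..M}"])
    (use assms in \<open>auto simp: set_hedge_pmf pmf_hedge_pmf sum_divide_distrib mult.commute intro!: sum.cong\<close>)

section \<open>Lazy resampling with a prescribed marginal law\<close>

definition lazy_step :: "(nat \<Rightarrow> real) \<Rightarrow> nat pmf \<Rightarrow> nat \<Rightarrow> nat pmf" where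
  "lazy_step \<kappa> P j = bernoulli_pmf (\<kappa> j) \<bind> (\<lambda>b. if b then return_pmf j else P)"

lemma set_lazy_step: "set_pmf (lazy_step \<kappa> P j) \<subseteq> insert j (set_pmf P)"
  by (auto simp: lazy_step_def split: if_splits)

lemma pmf_lazy_step:
  assumes "0 \<le> \<kappa> j" "\<kappa> j \<le> 1"
  shows "pmf (lazy_step \<kappa> P j) i = \<kappa> j * indicator {j} i + (1 - \<kappa> j) * pmf P i"
  using assms by (simp add: lazy_step_def pmf_bind indicator_def)

text \<open>The surcharge \<open>b\<close> is paid for every fresh draw, even one that happens to
  return \<open>j\<close>, so its expectation is at most \<open>b\<close> times the probability of
  resampling.\<close>

lemma expectation_lazy_step_le:
  fixes f :: "nat \<Rightarrow> real"
  assumes "0 \<le> \<kappa> j" "\<kappa> j \<le> 1" "finite (set_pmf P)"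
    and "f j \<le> a" "\<And>i. i \<in> set_pmf P \<Longrightarrow> f i \<le> a + b"
  shows "measure_pmf.expectation (lazy_step \<kappa> P j) f \<le> a + b * (1 - \<kappa> j)"
proof -
  have "measure_pmf.expectation (lazy_step \<kappa> P j) f =
      (\<Sum>c\<in>UNIV. pmf (bernoulli_pmf (\<kappa> j)) c *
        measure_pmf.expectation (if c then return_pmf j else P) f)"
    unfolding lazy_step_def using assms(3) by (subst pmf_expectation_bind[of UNIV]) auto
  also have "\<dots> = \<kappa> j * f j + (1 - \<kappa> j) * measure_pmf.expectation P f"
    using assms(1,2) by (simp add: UNIV_bool)
  also have "measure_pmf.expectation P f \<le> a + b"
    using assms(3,5)
    by (intro measure_pmf.integral_le_const) (auto simp: integrable_measure_pmf_finite AE_measure_pmf_iff)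
  then have "\<kappa> j * f j + (1 - \<kappa> j) * measure_pmf.expectation P f \<le> \<kappa> j * a + (1 - \<kappa> j) * (a + b)"
    using assms by (intro add_mono mult_left_mono) auto
  finally show ?thesis by (simp add: algebra_simps)
qed

text \<open>The mass kept at \<open>i\<close> is \<open>c * pmf P' i\<close>. Summing over
  \<open>i\<close> shows that \<open>c\<close> is the total mass kept, and the remaining
  \<open>1 - c\<close> is redistributed according to \<open>P'\<close>, which completes
  \<open>pmf P' i\<close>.\<close>

lemma bind_lazy_step:
  assumes "finite (set_pmf P)" "\<And>j. j \<in> set_pmf P \<Longrightarrow> 0 \<le> \<kappa> j \<and> \<kappa> j \<le> 1"
    and c: "\<And>j. pmf P j * \<kappa> j = c * pmf P' j" and sub: "set_pmf P' \<subseteq> set_pmf P"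
  shows "P \<bind> lazy_step \<kappa> P' = P'"
proof (rule pmf_eqI)
  fix i
  let ?S = "set_pmf P"
  have "(\<Sum>j\<in>?S. pmf P j * \<kappa> j) = c * (\<Sum>j\<in>?S. pmf P' j)"
    by (simp add: c sum_distrib_left)
  also have "(\<Sum>j\<in>?S. pmf P' j) = 1"
    by (rule sum_pmf_eq_1) (use assms in auto)
  finally have sum_c: "(\<Sum>j\<in>?S. pmf P j * \<kappa> j) = c" by simp
  have "pmf (P \<bind> lazy_step \<kappa> P') i = (\<Sum>j\<in>?S. pmf (lazy_step \<kappa> P' j) i * pmf P j)"
    unfolding pmf_bind by (rule integral_measure_pmf_real) (use assms in auto)
  also have "\<dots> = (\<Sum>j\<in>?S. (if j = i then pmf P i * \<kappa> i else 0) + pmf P' i * (pmf P j - pmf P j * \<kappa> j))"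
    by (rule sum.cong) (use assms(2) in \<open>auto simp: pmf_lazy_step algebra_simps\<close>)
  also have "\<dots> = (if i \<in> ?S then pmf P i * \<kappa> i else 0)
      + pmf P' i * ((\<Sum>j\<in>?S. pmf P j) - (\<Sum>j\<in>?S. pmf P j * \<kappa> j))"
    using assms(1) by (simp add: sum.distrib sum_distrib_left[symmetric] sum_subtractf)
  also have "(if i \<in> ?S then pmf P i * \<kappa> i else 0) = c * pmf P' i"
    using c[of i] by (auto simp: set_pmf_iff)
  also have "(\<Sum>j\<in>?S. pmf P j) = 1"
    using assms(1) by (intro sum_pmf_eq_1) auto
  finally show "pmf (P \<bind> lazy_step \<kappa> P') i = pmf P' i"
    unfolding sum_c by (simp add: algebra_simps)
qed

section \<open>Exponential inequalities and the regret of Hedge\<close>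

lemma exp_mult_ge:
  fixes z r :: real
  assumes "1 \<le> r"
  shows "1 + r * (exp z - 1) \<le> exp (r * z)"
proof -
  have "(exp z - 1) \<le> exp z * z"
  proof -
    have "1 - z \<le> exp (- z)" using exp_ge_add_one_self[of "- z"] by simp
    then have "exp z * (1 - z) \<le> exp z * exp (- z)" by (intro mult_left_mono) auto
    then show ?thesis by (simp add: algebra_simps flip: exp_add)
  qed
  then have "(r - 1) * (exp z - 1) \<le> (r - 1) * (exp z * z)"
    using assms by (intro mult_left_mono) auto
  also have "\<dots> = exp z * ((r - 1) * z)" by simp
  also have "\<dots> \<le> exp z * (exp ((r - 1) * z) - 1)"
    using exp_ge_add_one_self[of "(r - 1) * z"] by (intro mult_left_mono) (linarith | simp)+
  also have "\<dots> = exp (r * z) - exp z"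
    by (simp add: algebra_simps flip: exp_add)
  finally show ?thesis by (simp add: algebra_simps)
qed

text \<open>Both sides are multiplied by \<open>1 + x \<le> exp x\<close>: the left becomes at most
  \<open>1\<close>, the right becomes \<open>1 + x ^ 3\<close>.\<close>

lemma exp_minus_le_quadratic:
  fixes x :: real
  assumes "0 \<le> x"
  shows "exp (- x) \<le> 1 - x + x\<^sup>2"
proof -
  have "exp (- x) * (1 + x) \<le> exp (- x) * exp x"
    using exp_ge_add_one_self[of x] by (intro mult_left_mono) auto
  also have "\<dots> = 1" by (simp flip: exp_add)
  also have "1 \<le> (1 - x + x\<^sup>2) * (1 + x)"
    using assms by (simp add: algebra_simps power2_eq_square)
  finally show ?thesis using assms by (simp add: mult_le_cancel_right)
qed

text \<open>The soft minimum of \<open>x\<close> at inverse temperature \<open>e\<close>. Averaging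
  over the experts instead of summing makes it vanish at zero losses and decrease in
  \<open>e\<close>, so that lowering the learning rate never lowers it.\<close>

definition hedge_potential :: "nat \<Rightarrow> real \<Rightarrow> (nat \<Rightarrow> real) \<Rightarrow> real" where
  "hedge_potential M e x = - ln ((\<Sum>j=1..M. exp (- (e * x j))) / real M) / e"

text \<open>The power mean inequality for the numbers \<open>exp (- x j)\<close> with exponents
  \<open>a \<le> b\<close>, derived from Bernoulli's inequality in the form
  \<open>exp_mult_ge\<close>.\<close>

lemma hedge_potential_antimono:
  assumes M: "M \<ge> 1" and "0 < a" "a \<le> b"
  shows "hedge_potential M b x \<le> hedge_potential M a x"
proof -
  let ?A = "\<lambda>e. (\<Sum>j=1..M. exp (- (e * x j))) / real M"
  have pos: "0 < ?A e" for e
    using hedge_norm_pos[OF M, of "\<lambda>j. e * x j"] M by simp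
  define r where "r = b / a"
  have r: "1 \<le> r" using assms by (simp add: r_def)
  define c where "c = ln (?A a)"
  have expc: "exp c = ?A a" unfolding c_def by (rule exp_ln[OF pos])
  have one: "(\<Sum>j=1..M. exp (- (a * x j) - c)) = real M"
    using M hedge_norm_pos[OF M, of "\<lambda>j. a * x j"]
    unfolding exp_diff expc sum_divide_distrib[symmetric] by simp
  \<comment> \<open>After division by their mean \<open>exp c\<close> the weights add up to
    \<open>M\<close>, so the linear terms of Bernoulli's inequality cancel in the sum.\<close>
  have "real M = (\<Sum>j=1..M. 1 + r * (exp (- (a * x j) - c) - 1))"
    unfolding sum.distrib sum_distrib_left[symmetric] sum_subtractf one by simp
  also have "\<dots> \<le> (\<Sum>j=1..M. exp (r * (- (a * x j) - c)))"
    by (intro sum_mono exp_mult_ge r)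
  also have "\<dots> = (\<Sum>j=1..M. exp (- (b * x j))) / exp (r * c)"
    unfolding sum_divide_distrib exp_diff[symmetric]
    by (intro sum.cong refl arg_cong[where f = exp]) (use assms in \<open>simp add: r_def field_simps\<close>)
  finally have "exp (r * c) \<le> ?A b"
    using M by (simp add: field_simps)
  then have "r * c \<le> ln (?A b)"
    using pos[of b] by (simp add: ln_ge_iff)
  then show ?thesis
    using assms unfolding hedge_potential_def c_def r_def by (simp add: field_simps)
qed

text \<open>The increments lie in \<open>[0, 1]\<close>, so the quadratic bound on
  \<open>exp\<close> applies with error at most \<open>e\<^sup>2\<close> to the ratio of total
  weights; taking logarithms and dividing by \<open>e\<close> leaves the error
  \<open>e\<close>.\<close>

lemma hedge_potential_step:
  assumes M: "M \<ge> 1" and e: "0 < e"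
    and l: "\<And>j. j \<in> {1..M} \<Longrightarrow> x j \<le> y j \<and> y j \<le> x j + 1"
  shows "measure_pmf.expectation (hedge_pmf M (\<lambda>j. e * x j)) (\<lambda>j. y j - x j)
    \<le> hedge_potential M e y - hedge_potential M e x + e"
proof -
  let ?W = "\<lambda>x. \<Sum>j=1..M. exp (- (e * x j))"
  have pos: "0 < ?W x" for x by (rule hedge_norm_pos[OF M])
  define m where "m = (\<Sum>j=1..M. exp (- (e * x j)) * (y j - x j)) / ?W x"
  have "?W y = (\<Sum>j=1..M. exp (- (e * x j)) * exp (- (e * (y j - x j))))"
    by (intro sum.cong) (auto simp: algebra_simps simp flip: exp_add)
  also have "\<dots> \<le> (\<Sum>j=1..M. exp (- (e * x j)) * (1 - e * (y j - x j) + e\<^sup>2))"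
  proof (intro sum_mono mult_left_mono)
    fix j assume j: "j \<in> {1..M}"
    have "exp (- (e * (y j - x j))) \<le> 1 - e * (y j - x j) + (e * (y j - x j))\<^sup>2"
      using l[OF j] e by (intro exp_minus_le_quadratic) auto
    moreover have "(e * (y j - x j))\<^sup>2 \<le> (e * 1)\<^sup>2"
      using l[OF j] e by (intro power_mono mult_left_mono) auto
    ultimately show "exp (- (e * (y j - x j))) \<le> 1 - e * (y j - x j) + e\<^sup>2" by simp
  qed simp
  also have "\<dots> = (\<Sum>j=1..M. (1 + e\<^sup>2) * exp (- (e * x j)) - e * (exp (- (e * x j)) * (y j - x j)))"
    by (intro sum.cong) (auto simp: algebra_simps)
  also have "\<dots> = (1 + e\<^sup>2) * ?W x - e * (m * ?W x)"
    using pos[of x] by (simp add: sum_subtractf sum_distrib_left[symmetric] m_def)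
  finally have "?W y \<le> ?W x * (1 - e * m + e\<^sup>2)"
    by (simp add: algebra_simps)
  then have "?W y / ?W x \<le> 1 - e * m + e\<^sup>2"
    using pos[of x] by (simp add: field_simps)
  moreover have "ln (?W y / ?W x) \<le> ?W y / ?W x - 1"
    using pos[of x] pos[of y] by (intro ln_le_minus_one) simp
  ultimately have "ln (?W y) - ln (?W x) \<le> - e * m + e\<^sup>2"
    using pos[of x] pos[of y] by (simp add: ln_div)
  then have "e * m \<le> ln (?W x) - ln (?W y) + e * e" by (simp add: power2_eq_square)
  then have "m \<le> (ln (?W x) - ln (?W y)) / e + e" using e by (simp add: field_simps)
  also have "(ln (?W x) - ln (?W y)) / e = hedge_potential M e y - hedge_potential M e x"
    using pos[of x] pos[of y] M by (simp add: hedge_potential_def ln_div diff_divide_distrib)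
  finally show ?thesis
    by (simp add: expectation_hedge_pmf[OF M] m_def)
qed

text \<open>The steps telescope, as the decrease of the learning rate between them can only raise
  the potential. At the end the soft minimum exceeds the loss of any single expert by at most
  \<open>ln (real M) / e T\<close>.\<close>

lemma hedge_regret:
  assumes M: "M \<ge> 1" and e: "\<And>t. 0 < e t" "\<And>t. e (Suc t) \<le> e t"
    and L0: "\<And>j. L 0 j = 0"
    and L: "\<And>t j. j \<in> {1..M} \<Longrightarrow> L t j \<le> L (Suc t) j \<and> L (Suc t) j \<le> L t j + 1"
    and i: "i \<in> {1..M}"
  shows "(\<Sum>t<T. measure_pmf.expectation (hedge_pmf M (\<lambda>j. e t * L t j)) (\<lambda>j. L (Suc t) j - L t j))
    \<le> L T i + ln (real M) / e T + (\<Sum>t<T. e t)"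
proof -
  have "(\<Sum>t<T. measure_pmf.expectation (hedge_pmf M (\<lambda>j. e t * L t j)) (\<lambda>j. L (Suc t) j - L t j))
    \<le> hedge_potential M (e T) (L T) + (\<Sum>t<T. e t)"
  proof (induction T)
    case 0
    then show ?case using M by (simp add: hedge_potential_def L0)
  next
    case (Suc T)
    have "measure_pmf.expectation (hedge_pmf M (\<lambda>j. e T * L T j)) (\<lambda>j. L (Suc T) j - L T j)
      \<le> hedge_potential M (e T) (L (Suc T)) - hedge_potential M (e T) (L T) + e T"
      by (rule hedge_potential_step[OF M e(1) L])
    moreover have "hedge_potential M (e T) (L (Suc T)) \<le> hedge_potential M (e (Suc T)) (L (Suc T))"
      by (rule hedge_potential_antimono[OF M e])
    ultimately show ?case using Suc by simp
  qed
  moreover have "hedge_potential M (e T) (L T) \<le> L T i + ln (real M) / e T"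
  proof -
    let ?W = "\<Sum>j=1..M. exp (- (e T * L T j))"
    have "exp (- (e T * L T i)) \<le> ?W"
      using i by (intro member_le_sum[where f = "\<lambda>j. exp (- (e T * L T j))"]) auto
    then have "- (e T * L T i) \<le> ln ?W"
      using hedge_norm_pos[OF M, of "\<lambda>j. e T * L T j"] by (simp add: ln_ge_iff)
    moreover have "ln (?W / real M) = ln ?W - ln (real M)"
      using hedge_norm_pos[OF M, of "\<lambda>j. e T * L T j"] M by (subst ln_div) auto
    ultimately have "- ln (?W / real M) \<le> e T * L T i + ln (real M)" by simp
    then have "- ln (?W / real M) / e T \<le> (e T * L T i + ln (real M)) / e T"
      using e(1)[of T] by (intro divide_right_mono) auto
    also have "\<dots> = L T i + ln (real M) / e T"
      using e(1)[of T] by (simp add: add_divide_distrib)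
    finally show ?thesis by (simp add: hedge_potential_def)
  qed
  ultimately show ?thesis by linarith
qed

lemma sum_inverse_sqrt_le: "(\<Sum>t<T. 1 / sqrt (real (Suc t))) \<le> 2 * sqrt (real T)"
proof (induction T)
  case (Suc T)
  let ?a = "sqrt (real T)" and ?b = "sqrt (real (Suc T))"
  have b: "0 < ?b" by simp
  have "?b * ?b - ?a * ?a = 1" by simp
  then have "1 / ?b = (?b - ?a) * (?b + ?a) / ?b" by (simp add: algebra_simps)
  also have "\<dots> \<le> (?b - ?a) * (2 * ?b) / ?b"
    using b by (intro divide_right_mono mult_left_mono) auto
  also have "\<dots> = 2 * (?b - ?a)" using b by simp
  finally show ?case using Suc by simp
qed simp

text \<open>Summation by parts; it bounds the switches caused by the drift of the learning rate by
  the sum of the rates.\<close>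

lemma sum_diff_mult_Suc:
  fixes e :: "nat \<Rightarrow> real"
  shows "(\<Sum>t<T. (e t - e (Suc t)) * real (Suc t)) = (\<Sum>t<T. e t) - real T * e T"
  by (induction T) (simp_all add: algebra_simps)

section \<open>Lazily following the experts\<close>

text \<open>Here \<open>t\<close> is the number of finished rounds, so \<open>Suc t\<close> avoids a
  zero denominator at the start. The rate balances \<open>ln (real M) / e\<close> against switching
  costs of order \<open>k * e\<close> per round; it decreases because the horizon is unknown to the
  algorithm.\<close>

definition learning_rate :: "nat \<Rightarrow> nat \<Rightarrow> nat \<Rightarrow> real" where
  "learning_rate M k t = sqrt (ln (real M) / (real k * real (Suc t)))"

definition expert_loss ::
  "nat \<Rightarrow> (nat \<Rightarrow> page) \<Rightarrow> (nat \<Rightarrow> nat \<Rightarrow> nat) \<Rightarrow> nat \<Rightarrow> nat \<Rightarrow> real" where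
  "expert_loss k \<sigma> p t j = real (misses t \<sigma> (expert_cache k \<sigma> (p j)))"

definition expert_dist ::
  "nat \<Rightarrow> nat \<Rightarrow> (nat \<Rightarrow> page) \<Rightarrow> (nat \<Rightarrow> nat \<Rightarrow> nat) \<Rightarrow> nat \<Rightarrow> nat pmf" where
  "expert_dist M k \<sigma> p t = hedge_pmf M (\<lambda>j. learning_rate M k t * expert_loss k \<sigma> p t j)"

text \<open>
  Up to normalisation, the ratio of the weights of expert \<open>j\<close> after rounds \<open>Suc t\<close> and \<open>t\<close>. The last
  term in the exponent, which does not depend on \<open>j\<close>, keeps it below \<open>1\<close> although the learning rate
  decreases.
\<close>

definition stay_prob ::
  "nat \<Rightarrow> nat \<Rightarrow> (nat \<Rightarrow> page) \<Rightarrow> (nat \<Rightarrow> nat \<Rightarrow> nat) \<Rightarrow> nat \<Rightarrow> nat \<Rightarrow> real" where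
  "stay_prob M k \<sigma> p t j =
     exp (learning_rate M k t * expert_loss k \<sigma> p t j
        - learning_rate M k (Suc t) * expert_loss k \<sigma> p (Suc t) j
        - (learning_rate M k t - learning_rate M k (Suc t)) * real (Suc t))"

text \<open>The private draws record the experts followed. Before the first round there is none, and
  the initial law supplies one.\<close>

definition last_expert ::
  "nat \<Rightarrow> nat \<Rightarrow> (nat \<Rightarrow> page) \<Rightarrow> (nat \<Rightarrow> nat \<Rightarrow> nat) \<Rightarrow> nat \<Rightarrow> nat list \<Rightarrow> nat pmf" where
  "last_expert M k \<sigma> p t rs = (if rs = [] then expert_dist M k \<sigma> p t else return_pmf (last rs))"

definition next_expert ::
  "nat \<Rightarrow> nat \<Rightarrow> (nat \<Rightarrow> page) \<Rightarrow> (nat \<Rightarrow> nat \<Rightarrow> nat) \<Rightarrow> nat \<Rightarrow> nat list \<Rightarrow> nat pmf" where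
  "next_expert M k \<sigma> p t rs =
     last_expert M k \<sigma> p t rs \<bind> lazy_step (stay_prob M k \<sigma> p t) (expert_dist M k \<sigma> p (Suc t))"

text \<open>The case \<open>C \<subseteq> S\<close> is a default that keeps the choice inside
  \<open>C\<close>. At a miss, with \<open>S\<close> the cache of the followed expert, it cannot
  arise: \<open>S\<close> has at most \<open>card C\<close> pages and one of them is the requested
  page, missing from \<open>C\<close>.\<close>

definition evict :: "page set \<Rightarrow> page set \<Rightarrow> page" where
  "evict C S = (if C \<subseteq> S then SOME e. e \<in> C else SOME e. e \<in> C - S)"

text \<open>Lists are indexed from 0 while rounds and predictors start at 1, hence the shifts by
  one. The target is the expert's cache at the end of the current round \<open>Suc t\<close>, which
  the predictions up to round \<open>t\<close> determine.\<close>

definition follow_alg :: rand_alg where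
  "follow_alg v =
     (let t = length (requests v) - 1;
          \<sigma> = (\<lambda>u. requests v ! (u - 1));
          p = (\<lambda>j u. predictions v ! (u - 1) ! (j - 1))
      in map_pmf (\<lambda>j. (evict (last (caches v)) (expert_cache (cache_size v) \<sigma> (p j) (Suc t)), j))
           (next_expert (num_predictors v) (cache_size v) \<sigma> p t (draws v)))"

lemma evict_in_Diff:
  assumes "\<not> C \<subseteq> S"
  shows "evict C S \<in> C - S"
proof -
  from assms have "\<exists>e. e \<in> C - S" by blast
  then have "(SOME e. e \<in> C - S) \<in> C - S" by (rule someI_ex)
  then show ?thesis using assms by (simp add: evict_def)
qed

lemma evict_in:
  assumes "C \<noteq> {}"
  shows "evict C S \<in> C"
proof (cases "C \<subseteq> S")
  case True
  then show ?thesis using assms by (simp add: evict_def some_in_eq)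
qed (use evict_in_Diff in blast)

lemma rand_paging_alg_follow_alg: "rand_paging_alg follow_alg"
  by (auto simp: rand_paging_alg_def follow_alg_def Let_def evict_in)

text \<open>The potential \<open>card (S - C)\<close> pays for the misses of the follower on pages the expert has.\<close>

lemma follow_potential:
  fixes C S S' :: "page set"
  assumes C: "finite C" "card C = k" and S: "finite S" "finite S'" "card S' \<le> k"
    and sub: "S' \<subseteq> insert x S" "x \<in> S'"
  shows "of_bool (x \<notin> C) + card (S' - serve C x (evict C S')) \<le> of_bool (x \<notin> S) + card (S - C)"
proof (cases "x \<in> C")
  case True
  then have "card (S' - C) \<le> card (S - C)" using S sub by (intro card_mono) auto
  then show ?thesis using True by (simp add: serve_def)
next
  case False
  have "\<not> C \<subseteq> S'"
  proof
    assume "C \<subseteq> S'"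
    then have "C \<subset> S'" using False sub(2) by blast
    then have "card C < card S'" by (rule psubset_card_mono[OF S(2)])
    then show False using C S by simp
  qed
  then have "evict C S' \<notin> S'" using evict_in_Diff by blast
  then have "S' - serve C x (evict C S') \<subseteq> S - C - {x}"
    using False sub by (auto simp: serve_def)
  then have "card (S' - serve C x (evict C S')) \<le> card (S - C - {x})"
    using S by (intro card_mono) auto
  \<comment> \<open>If the expert holds \<open>x\<close>, the potential falls by one and pays for
    the miss; otherwise the expert misses too.\<close>
  moreover have "card (S - C - {x}) + of_bool (x \<in> S) = card (S - C)"
    using False S card_Suc_Diff1[of "S - C" x] by (cases "x \<in> S") auto
  ultimately show ?thesis using False by (cases "x \<in> S") auto
qed

text \<open>A miss is either shared with the old expert or certifies that the old potential is
  positive; the new potential never exceeds \<open>card S'\<close>, whatever the new cache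
  \<open>D\<close> is.\<close>

lemma switch_potential:
  fixes C S S' :: "page set"
  assumes "finite S" "finite S'" "card S' \<le> k"
  shows "of_bool (x \<notin> C) + card (S' - D) \<le> of_bool (x \<notin> S) + card (S - C) + k"
proof -
  have "card (S' - D) \<le> card S'" using assms by (intro card_mono) auto
  moreover have "of_bool (x \<notin> C) \<le> of_bool (x \<notin> S) + card (S - C)"
  proof (cases "x \<in> S - C")
    case True
    then have "0 < card (S - C)" using assms(1) by (auto simp: card_gt_0_iff)
    then show ?thesis by simp
  qed auto
  ultimately show ?thesis using assms(3) by linarith
qed

lemma card_serve:
  assumes "finite C" "card C = k" "e \<in> C"
  shows "finite (serve C x e)" "card (serve C x e) = k"
proof -
  have "0 < card C" using assms by (auto simp: card_gt_0_iff)
  then show "finite (serve C x e)" "card (serve C x e) = k"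
    using assms by (auto simp: serve_def)
qed

lemma misses_Suc: "misses (Suc t) \<sigma> C = misses t \<sigma> C + of_bool (\<sigma> (Suc t) \<notin> C t)"
proof -
  let ?B = "{s \<in> {1..t}. \<sigma> s \<notin> C (s - 1)}"
  have "{s \<in> {1..Suc t}. \<sigma> s \<notin> C (s - 1)} = (if \<sigma> (Suc t) \<notin> C t then insert (Suc t) ?B else ?B)"
    by (auto simp: le_Suc_eq)
  moreover have "finite ?B" "Suc t \<notin> ?B" by auto
  ultimately show ?thesis by (simp add: misses_def)
qed

lemma misses_cong:
  assumes "\<And>s. s \<in> {1..t} \<Longrightarrow> \<sigma> s = \<sigma>' s" "\<And>s. s < t \<Longrightarrow> C s = C' s"
  shows "misses t \<sigma> C = misses t \<sigma>' C'"
proof -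
  have "{s \<in> {1..t}. \<sigma> s \<notin> C (s - 1)} = {s \<in> {1..t}. \<sigma>' s \<notin> C' (s - 1)}"
  proof (rule Collect_cong)
    fix s
    show "(s \<in> {1..t} \<and> \<sigma> s \<notin> C (s - 1)) = (s \<in> {1..t} \<and> \<sigma>' s \<notin> C' (s - 1))"
      using assms(1)[of s] assms(2)[of "s - 1"] by (cases "s \<in> {1..t}") auto
  qed
  then show ?thesis by (simp only: misses_def)
qed

lemma misses_le: "misses t \<sigma> C \<le> t"
  by (simp add: misses_eq)

lemma expert_loss_cong:
  assumes "\<And>s. s \<in> {1..t} \<Longrightarrow> \<sigma> s = \<sigma>' s" "\<And>s. s \<in> {1..<t} \<Longrightarrow> p j s = p' j s"
  shows "expert_loss k \<sigma> p t j = expert_loss k \<sigma>' p' t j"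
  unfolding expert_loss_def
  by (intro arg_cong[where f = real] misses_cong expert_cache_cong) (use assms in auto)

lemma expert_loss_0 [simp]: "expert_loss k \<sigma> p 0 j = 0"
  by (simp add: expert_loss_def misses_def)

lemma expert_loss_Suc:
  "expert_loss k \<sigma> p (Suc t) j =
     expert_loss k \<sigma> p t j + of_bool (\<sigma> (Suc t) \<notin> expert_cache k \<sigma> (p j) t)"
  by (simp add: expert_loss_def misses_Suc)

lemma expert_loss_le: "expert_loss k \<sigma> p t j \<le> real t"
  by (simp add: expert_loss_def misses_le)

lemma learning_rate_antimono:
  assumes "M \<ge> 1" "k \<ge> 1"
  shows "learning_rate M k (Suc t) \<le> learning_rate M k t"
  unfolding learning_rate_def
  by (intro real_sqrt_le_mono divide_left_mono mult_left_mono) (use assms in auto)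

lemma learning_rate_nonneg: "M \<ge> 1 \<Longrightarrow> 0 \<le> learning_rate M k t"
  by (simp add: learning_rate_def)

text \<open>The exponent is \<open>- y\<close>, where \<open>y\<close> adds the rate times the loss
  increment to the drop of the rate times \<open>real (Suc t) - L\<close>. Both parts are
  nonnegative because a loss is at most the number of rounds, and
  \<open>1 - exp (- y) \<le> y\<close>.\<close>

lemma stay_prob_bounds:
  assumes "M \<ge> 1" "k \<ge> 1"
  shows "0 \<le> stay_prob M k \<sigma> p t j" "stay_prob M k \<sigma> p t j \<le> 1"
    "1 - stay_prob M k \<sigma> p t j \<le> learning_rate M k (Suc t)
       + (learning_rate M k t - learning_rate M k (Suc t)) * real (Suc t)"
proof -
  define a b L l where "a = learning_rate M k t" "b = learning_rate M k (Suc t)"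
    "L = expert_loss k \<sigma> p t j" "l = expert_loss k \<sigma> p (Suc t) j - L"
  define y where "y = b * l + (a - b) * (real (Suc t) - L)"
  have stay: "stay_prob M k \<sigma> p t j = exp (- y)"
    unfolding stay_prob_def y_def a_b_L_l_def by (simp add: algebra_simps)
  have ab: "0 \<le> b" "b \<le> a"
    using learning_rate_nonneg learning_rate_antimono assms by (auto simp: a_b_L_l_def)
  have l: "0 \<le> l" "l \<le> 1" by (auto simp: a_b_L_l_def expert_loss_Suc)
  have L: "0 \<le> L" "L \<le> real t" using expert_loss_le by (auto simp: a_b_L_l_def expert_loss_def)
  have y0: "0 \<le> y" unfolding y_def using ab l L by (intro add_nonneg_nonneg mult_nonneg_nonneg) auto
  have "b * l \<le> b * 1" using ab l by (intro mult_left_mono) auto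
  moreover have "(a - b) * (real (Suc t) - L) \<le> (a - b) * real (Suc t)"
    using ab L by (intro mult_left_mono) auto
  ultimately have y1: "y \<le> b + (a - b) * real (Suc t)" by (simp add: y_def)
  show "0 \<le> stay_prob M k \<sigma> p t j" "stay_prob M k \<sigma> p t j \<le> 1"
    unfolding stay using y0 by auto
  have "1 - exp (- y) \<le> y" using exp_ge_add_one_self[of "- y"] by simp
  with y1 show "1 - stay_prob M k \<sigma> p t j \<le> learning_rate M k (Suc t)
       + (learning_rate M k t - learning_rate M k (Suc t)) * real (Suc t)"
    unfolding stay a_b_L_l_def by simp
qed

lemma expert_dist_step:
  assumes "M \<ge> 1" "k \<ge> 1"
  shows "expert_dist M k \<sigma> p t \<bind> lazy_step (stay_prob M k \<sigma> p t) (expert_dist M k \<sigma> p (Suc t))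
    = expert_dist M k \<sigma> p (Suc t)"
proof -
  define W where "W t = (\<Sum>i=1..M. exp (- (learning_rate M k t * expert_loss k \<sigma> p t i)))" for t
  define d where "d = (learning_rate M k t - learning_rate M k (Suc t)) * real (Suc t)"
  have W: "0 < W t" for t unfolding W_def by (rule hedge_norm_pos[OF assms(1)])
  show ?thesis
  \<comment> \<open>In \<open>pmf * stay_prob\<close> the old weight cancels and the new weight
    appears; what is left, the normalisers and the summand \<open>d\<close> of the exponent, is the
    same for all experts.\<close>
  proof (rule bind_lazy_step[where c = "exp (- d) * W (Suc t) / W t"])
    fix j
    show "pmf (expert_dist M k \<sigma> p t) j * stay_prob M k \<sigma> p t j =
        exp (- d) * W (Suc t) / W t * pmf (expert_dist M k \<sigma> p (Suc t)) j"
      unfolding expert_dist_def pmf_hedge_pmf[OF assms(1)] W_def[symmetric] stay_prob_def d_def[symmetric]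
      using W[of t] W[of "Suc t"] by (simp add: exp_diff exp_minus exp_add field_simps)
  qed (use stay_prob_bounds[OF assms] assms in \<open>auto simp: expert_dist_def set_hedge_pmf\<close>)
qed

lemma expectation_bind_finite:
  fixes h :: "'b \<Rightarrow> real"
  assumes "finite (set_pmf P)" "\<And>x. x \<in> set_pmf P \<Longrightarrow> finite (set_pmf (f x))"
  shows "measure_pmf.expectation (P \<bind> f) h =
    measure_pmf.expectation P (\<lambda>x. measure_pmf.expectation (f x) h)"
  using assms
  by (subst pmf_expectation_bind[of "set_pmf P"]) (auto simp: integral_measure_pmf[of "set_pmf P"])

lemma expectation_mono_finite:
  fixes f g :: "'a \<Rightarrow> real"
  assumes "finite (set_pmf P)" "\<And>x. x \<in> set_pmf P \<Longrightarrow> f x \<le> g x"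
  shows "measure_pmf.expectation P f \<le> measure_pmf.expectation P g"
  using assms by (intro integral_mono_AE) (auto simp: integrable_measure_pmf_finite AE_measure_pmf_iff)

section \<open>Expected cost of the follower\<close>

locale followed_experts =
  fixes n k M :: nat and C0 :: "page set" and \<sigma> :: "nat \<Rightarrow> page" and p :: "nat \<Rightarrow> nat \<Rightarrow> nat"
  assumes k: "k \<ge> 1" and M: "M \<ge> 1" and C0: "finite C0" "card C0 = k"
begin

abbreviation "S j t \<equiv> expert_cache k \<sigma> (p j) t"
abbreviation "law t \<equiv> expert_dist M k \<sigma> p t"
abbreviation "loss t j \<equiv> expert_loss k \<sigma> p t j"
abbreviation "history t \<equiv> run follow_alg n k M C0 \<sigma> p t"

lemma set_law: "set_pmf (law t) = {1..M}"
  using M by (simp add: expert_dist_def set_hedge_pmf)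

lemma set_last_expert:
  "rs = [] \<or> last rs \<in> {1..M} \<Longrightarrow> set_pmf (last_expert M k \<sigma> p t rs) \<subseteq> {1..M}"
  by (auto simp: last_expert_def set_law)

lemma set_next_expert:
  assumes "rs = [] \<or> last rs \<in> {1..M}"
  shows "set_pmf (next_expert M k \<sigma> p t rs) \<subseteq> {1..M}"
  using set_last_expert[OF assms, of t] set_lazy_step[of _ "law (Suc t)"] set_law[of "Suc t"]
  unfolding next_expert_def by (simp add: subset_iff) blast

text \<open>The requests and predictions decoded from the view agree with the true ones only on what
  has been revealed; the congruence lemmas show that nothing else enters. The condition on
  \<open>rs\<close> keeps the remembered expert within the range of the prediction lists.\<close>

lemma follow_alg_view_at:
  assumes rs: "rs = [] \<or> last rs \<in> {1..M}"
  shows "follow_alg (view_at n k M \<sigma> p (Suc t) Cs rs) =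
    map_pmf (\<lambda>j. (evict (last Cs) (S j (Suc t)), j)) (next_expert M k \<sigma> p t rs)"
proof -
  let ?v = "view_at n k M \<sigma> p (Suc t) Cs rs"
  define \<sigma>' where "\<sigma>' = (\<lambda>u. requests ?v ! (u - 1))"
  define p' where "p' = (\<lambda>j u. predictions ?v ! (u - 1) ! (j - 1))"
  have \<sigma>': "\<sigma>' u = \<sigma> u" if "u \<in> {1..Suc t}" for u
    using that by (cases u) (simp_all add: \<sigma>'_def view_at_def nth_map_upt del: upt_Suc)
  have p': "p' j u = p j u" if "j \<in> {1..M}" "u \<in> {1..<Suc t}" for j u
    using that by (cases j; cases u) (simp_all add: p'_def view_at_def nth_map_upt del: upt_Suc)
  have loss: "expert_loss k \<sigma>' p' s j = loss s j" if "j \<in> {1..M}" "s \<le> Suc t" for j s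
    by (rule expert_loss_cong) (use that \<sigma>' p' in auto)
  have cache: "expert_cache k \<sigma>' (p' j) (Suc t) = S j (Suc t)" if "j \<in> {1..M}" for j
    by (rule expert_cache_cong) (use that \<sigma>' p' in auto)
  have law: "expert_dist M k \<sigma>' p' s = law s" if "s \<le> Suc t" for s
    unfolding expert_dist_def by (rule pmf_eqI) (use M loss that in \<open>simp add: pmf_hedge_pmf\<close>)
  have last: "last_expert M k \<sigma>' p' t rs = last_expert M k \<sigma> p t rs"
    by (simp add: last_expert_def law)
  have "next_expert M k \<sigma>' p' t rs = next_expert M k \<sigma> p t rs"
    unfolding next_expert_def last
  proof (rule bind_pmf_cong[OF refl])
    fix j assume "j \<in> set_pmf (last_expert M k \<sigma> p t rs)"
    then have "j \<in> {1..M}" using set_last_expert[OF rs] by blast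
    then show "lazy_step (stay_prob M k \<sigma>' p' t) (expert_dist M k \<sigma>' p' (Suc t)) j =
        lazy_step (stay_prob M k \<sigma> p t) (law (Suc t)) j"
      by (simp add: lazy_step_def stay_prob_def loss law)
  qed
  moreover have "follow_alg ?v =
      map_pmf (\<lambda>j. (evict (last Cs) (expert_cache k \<sigma>' (p' j) (Suc t)), j)) (next_expert M k \<sigma>' p' t rs)"
    unfolding \<sigma>'_def p'_def by (simp add: follow_alg_def Let_def view_at_def del: upt_Suc)
  ultimately show ?thesis
    using set_next_expert[OF rs, of t] cache by (auto intro!: map_pmf_cong)
qed

lemma history_invariant:
  assumes "(Cs, rs) \<in> set_pmf (history t)"
  shows "length Cs = Suc t \<and> length rs = t \<and> finite (last Cs) \<and> card (last Cs) = k \<and>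
    (rs = [] \<or> last rs \<in> {1..M})"
  using assms
proof (induction t arbitrary: Cs rs)
  case 0
  then show ?case using C0 by simp
next
  case (Suc t)
  from Suc.prems obtain Cs' rs' e r where
    1: "(Cs', rs') \<in> set_pmf (history t)" and
    2: "(e, r) \<in> set_pmf (follow_alg (view_at n k M \<sigma> p (Suc t) Cs' rs'))" and
    3: "Cs = Cs' @ [serve (last Cs') (\<sigma> (Suc t)) e]" "rs = rs' @ [r]"
    by (auto simp del: upt_Suc)
  note IH = Suc.IH[OF 1]
  from IH 2 have r: "r \<in> set_pmf (next_expert M k \<sigma> p t rs')" and e: "e = evict (last Cs') (S r (Suc t))"
    by (auto simp: follow_alg_view_at)
  have "last Cs' \<noteq> {}" using IH k by auto
  then have "e \<in> last Cs'" unfolding e by (rule evict_in)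
  moreover have "r \<in> {1..M}" using r set_next_expert IH by blast
  ultimately show ?case
    using IH card_serve[of "last Cs'" k e "\<sigma> (Suc t)"] by (simp add: 3)
qed

lemma history_Suc:
  "history (Suc t) = history t \<bind> (\<lambda>(Cs, rs).
     map_pmf (\<lambda>j. (Cs @ [serve (last Cs) (\<sigma> (Suc t)) (evict (last Cs) (S j (Suc t)))], rs @ [j]))
       (next_expert M k \<sigma> p t rs))"
  unfolding run.simps
proof (rule bind_pmf_cong[OF refl], clarify)
  fix Cs rs assume "(Cs, rs) \<in> set_pmf (history t)"
  then have "rs = [] \<or> last rs \<in> {1..M}" using history_invariant by blast
  then show "follow_alg (view_at n k M \<sigma> p (Suc t) Cs rs) \<bind>
      (\<lambda>(e, r). return_pmf (Cs @ [serve (last Cs) (\<sigma> (Suc t)) e], rs @ [r])) =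
    map_pmf (\<lambda>j. (Cs @ [serve (last Cs) (\<sigma> (Suc t)) (evict (last Cs) (S j (Suc t)))], rs @ [j]))
       (next_expert M k \<sigma> p t rs)"
    by (simp add: follow_alg_view_at map_pmf_def bind_assoc_pmf bind_return_pmf)
qed

lemma finite_next_expert:
  "(Cs, rs) \<in> set_pmf (history t) \<Longrightarrow> finite (set_pmf (next_expert M k \<sigma> p t rs))"
  using set_next_expert history_invariant by (meson finite_atLeastAtMost finite_subset)

lemma finite_last_expert:
  "(Cs, rs) \<in> set_pmf (history t) \<Longrightarrow> finite (set_pmf (last_expert M k \<sigma> p t rs))"
  using set_last_expert history_invariant by (meson finite_atLeastAtMost finite_subset)

lemma finite_history: "finite (set_pmf (history t))"
proof (induction t)
  case (Suc t)
  then show ?case unfolding history_Suc using finite_next_expert by auto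
qed simp

text \<open>Although the draws of different rounds are correlated, each followed expert has exactly
  the Hedge law, so the regret bound for Hedge applies to it.\<close>

lemma marginal_last_expert: "history t \<bind> (\<lambda>(Cs, rs). last_expert M k \<sigma> p t rs) = law t"
proof (induction t)
  case 0
  then show ?case by (simp add: bind_return_pmf last_expert_def)
next
  case (Suc t)
  let ?f = "lazy_step (stay_prob M k \<sigma> p t) (law (Suc t))"
  have "history (Suc t) \<bind> (\<lambda>(Cs, rs). last_expert M k \<sigma> p (Suc t) rs) =
      history t \<bind> (\<lambda>(Cs, rs). next_expert M k \<sigma> p t rs)"
    unfolding history_Suc
    by (simp add: bind_assoc_pmf bind_map_pmf case_prod_unfold last_expert_def bind_return_pmf')
  also have "\<dots> = (history t \<bind> (\<lambda>(Cs, rs). last_expert M k \<sigma> p t rs)) \<bind> ?f"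
    by (simp add: next_expert_def bind_assoc_pmf case_prod_unfold)
  also have "\<dots> = law (Suc t)"
    unfolding Suc.IH by (rule expert_dist_step[OF M k])
  finally show ?case .
qed

definition cost_potential :: "nat \<Rightarrow> page set list \<times> nat list \<Rightarrow> real" where
  "cost_potential t = (\<lambda>(Cs, rs). real (misses t \<sigma> ((!) Cs) + card (S (last rs) t - last Cs)))"

text \<open>The bound of \<open>stay_prob_bounds\<close> on the probability of resampling, uniform
  in the expert.\<close>

definition switch_bound :: "nat \<Rightarrow> real" where
  "switch_bound t = learning_rate M k (Suc t)
     + (learning_rate M k t - learning_rate M k (Suc t)) * real (Suc t)"

text \<open>Given the previous expert \<open>i\<close>, keeping it costs no more than its own loss
  by \<open>follow_potential\<close>, and resampling costs at most \<open>k\<close> more by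
  \<open>switch_potential\<close>.\<close>

lemma cost_potential_step:
  assumes h: "(Cs, rs) \<in> set_pmf (history t)"
  shows "measure_pmf.expectation (next_expert M k \<sigma> p t rs)
      (\<lambda>j. cost_potential (Suc t)
         (Cs @ [serve (last Cs) (\<sigma> (Suc t)) (evict (last Cs) (S j (Suc t)))], rs @ [j]))
    \<le> cost_potential t (Cs, rs) + real k * switch_bound t
      + measure_pmf.expectation (last_expert M k \<sigma> p t rs) (\<lambda>i. loss (Suc t) i - loss t i)"
    (is "measure_pmf.expectation _ ?g \<le> _")
proof -
  note inv = history_invariant[OF h]
  let ?C = "last Cs" and ?x = "\<sigma> (Suc t)"
  have C: "finite ?C" "card ?C = k" using inv by auto
  have Ct: "Cs ! t = ?C" using inv by (subst last_conv_nth) auto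
  have miss: "misses (Suc t) \<sigma> ((!) (Cs @ [D])) = misses t \<sigma> ((!) Cs) + of_bool (?x \<notin> ?C)" for D
  proof -
    have "misses t \<sigma> ((!) (Cs @ [D])) = misses t \<sigma> ((!) Cs)"
      by (rule misses_cong) (use inv in \<open>auto simp: nth_append\<close>)
    then show ?thesis using inv Ct by (simp add: misses_Suc nth_append)
  qed
  have g: "?g j = real (misses t \<sigma> ((!) Cs)
      + (of_bool (?x \<notin> ?C) + card (S j (Suc t) - serve ?C ?x (evict ?C (S j (Suc t))))))" for j
    by (simp add: cost_potential_def miss)
  have step: "measure_pmf.expectation (lazy_step (stay_prob M k \<sigma> p t) (law (Suc t)) i) ?g
      \<le> cost_potential t (Cs, rs) + real k * switch_bound t + (loss (Suc t) i - loss t i)"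
    if i: "i \<in> set_pmf (last_expert M k \<sigma> p t rs)" for i
  proof -
    let ?a = "misses t \<sigma> ((!) Cs) + (of_bool (?x \<notin> S i t) + card (S i t - ?C))"
    have "?g i \<le> real ?a"
      unfolding g of_nat_le_iff
      by (intro add_left_mono follow_potential[OF C])
        (simp_all add: finite_expert_cache card_expert_cache[OF k] expert_cache_Suc_subset
          requested_in_expert_cache)
    moreover have "?g j \<le> real ?a + real k" for j
    proof -
      have "?g j \<le> real (misses t \<sigma> ((!) Cs) + (of_bool (?x \<notin> S i t) + card (S i t - ?C) + k))"
        unfolding g of_nat_le_iff
        by (intro add_left_mono switch_potential)
          (simp_all add: finite_expert_cache card_expert_cache[OF k])
      then show ?thesis by simp
    qed
    ultimately have "measure_pmf.expectation (lazy_step (stay_prob M k \<sigma> p t) (law (Suc t)) i) ?g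
        \<le> real ?a + real k * (1 - stay_prob M k \<sigma> p t i)"
      by (intro expectation_lazy_step_le stay_prob_bounds[OF M k]) (auto simp: set_law)
    also have "\<dots> \<le> real ?a + real k * switch_bound t"
      unfolding switch_bound_def by (intro add_left_mono mult_left_mono stay_prob_bounds[OF M k]) simp
    \<comment> \<open>With an empty record \<open>last rs\<close> is unspecified, but then
      \<open>t = 0\<close> and all expert caches are empty.\<close>
    also have "S i t - ?C = S (last rs) t - ?C"
    proof (cases "rs = []")
      case True
      then have "t = 0" using inv by simp
      then show ?thesis by simp
    next
      case False
      then show ?thesis using i by (simp add: last_expert_def)
    qed
    finally show ?thesis by (simp add: cost_potential_def expert_loss_Suc)
  qed
  have fin: "finite (set_pmf (last_expert M k \<sigma> p t rs))" by (rule finite_last_expert[OF h])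
  have "finite (set_pmf (lazy_step (stay_prob M k \<sigma> p t) (law (Suc t)) i))" for i
    by (rule finite_subset[OF set_lazy_step]) (simp add: set_law)
  then have "measure_pmf.expectation (next_expert M k \<sigma> p t rs) ?g =
      measure_pmf.expectation (last_expert M k \<sigma> p t rs)
        (\<lambda>i. measure_pmf.expectation (lazy_step (stay_prob M k \<sigma> p t) (law (Suc t)) i) ?g)"
    unfolding next_expert_def by (rule expectation_bind_finite[OF fin])
  also have "\<dots> \<le> measure_pmf.expectation (last_expert M k \<sigma> p t rs)
      (\<lambda>i. cost_potential t (Cs, rs) + real k * switch_bound t + (loss (Suc t) i - loss t i))"
    by (rule expectation_mono_finite[OF fin step])
  also have "\<dots> = cost_potential t (Cs, rs) + real k * switch_bound t
      + measure_pmf.expectation (last_expert M k \<sigma> p t rs) (\<lambda>i. loss (Suc t) i - loss t i)"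
    by (subst Bochner_Integration.integral_add)
      (simp_all add: integrable_measure_pmf_finite[OF fin] measure_pmf.prob_space)
  finally show ?thesis .
qed

lemma expectation_cost_potential:
  "measure_pmf.expectation (history T) (cost_potential T)
    \<le> (\<Sum>t<T. measure_pmf.expectation (law t) (\<lambda>i. loss (Suc t) i - loss t i))
      + real k * (\<Sum>t<T. switch_bound t)"
proof (induction T)
  case 0
  then show ?case by (simp add: cost_potential_def misses_def)
next
  case (Suc t)
  let ?H = "history t" and ?l = "\<lambda>i. loss (Suc t) i - loss t i"
  let ?E = "\<lambda>(Cs, rs). measure_pmf.expectation (last_expert M k \<sigma> p t rs) ?l"
  note int = integrable_measure_pmf_finite[OF finite_history]
  have "measure_pmf.expectation (history (Suc t)) (cost_potential (Suc t)) =
      measure_pmf.expectation ?H (\<lambda>(Cs, rs). measure_pmf.expectation (next_expert M k \<sigma> p t rs)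
      (\<lambda>j. cost_potential (Suc t)
         (Cs @ [serve (last Cs) (\<sigma> (Suc t)) (evict (last Cs) (S j (Suc t)))], rs @ [j])))"
    unfolding history_Suc
    by (subst expectation_bind_finite)
      (auto simp: finite_history finite_next_expert case_prod_unfold intro!: Bochner_Integration.integral_cong)
  also have "\<dots> \<le> measure_pmf.expectation ?H
      (\<lambda>h. cost_potential t h + real k * switch_bound t + ?E h)"
    using cost_potential_step by (intro expectation_mono_finite) (auto simp: finite_history)
  also have "\<dots> = measure_pmf.expectation ?H (cost_potential t) + real k * switch_bound t
      + measure_pmf.expectation ?H ?E"
    by (simp add: int measure_pmf.prob_space)
  also have "measure_pmf.expectation ?H ?E = measure_pmf.expectation (law t) ?l"
    unfolding marginal_last_expert[symmetric]
    by (subst expectation_bind_finite)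
      (auto simp: finite_history finite_last_expert case_prod_unfold intro!: Bochner_Integration.integral_cong)
  finally show ?case using Suc by (simp add: algebra_simps)
qed

lemma sum_learning_rate_le:
  "real k * (\<Sum>t<T. learning_rate M k t) \<le> 2 * sqrt (real T * real k * ln (real M))"
proof -
  have "learning_rate M k t = sqrt (ln (real M) / real k) * (1 / sqrt (real (Suc t)))" for t
    by (simp add: learning_rate_def real_sqrt_divide real_sqrt_mult)
  then have "(\<Sum>t<T. learning_rate M k t) = sqrt (ln (real M) / real k) * (\<Sum>t<T. 1 / sqrt (real (Suc t)))"
    by (simp add: sum_distrib_left)
  also have "\<dots> \<le> sqrt (ln (real M) / real k) * (2 * sqrt (real T))"
    using M by (intro mult_left_mono sum_inverse_sqrt_le) auto
  finally have "real k * (\<Sum>t<T. learning_rate M k t)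
      \<le> real k * (sqrt (ln (real M) / real k) * (2 * sqrt (real T)))"
    by (intro mult_left_mono) auto
  also have "real k * (sqrt (ln (real M) / real k) * (2 * sqrt (real T))) =
      2 * sqrt (real T) * sqrt (ln (real M)) * (real k / sqrt (real k))"
    by (simp add: real_sqrt_divide)
  also have "\<dots> = 2 * sqrt (real T * real k * ln (real M))"
    by (simp add: real_div_sqrt real_sqrt_mult)
  finally show ?thesis .
qed

lemma sum_switch_bound_le:
  "real k * (\<Sum>t<T. switch_bound t) \<le> 4 * sqrt (real T * real k * ln (real M))"
proof -
  let ?e = "learning_rate M k"
  have "(\<Sum>t<T. switch_bound t) = (\<Sum>t<T. ?e (Suc t)) + ((\<Sum>t<T. ?e t) - real T * ?e T)"
    unfolding switch_bound_def sum.distrib sum_diff_mult_Suc ..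
  also have "\<dots> \<le> (\<Sum>t<T. ?e t) + (\<Sum>t<T. ?e t)"
    using learning_rate_nonneg[OF M] learning_rate_antimono[OF M k]
    by (intro add_mono sum_mono) auto
  finally have "real k * (\<Sum>t<T. switch_bound t) \<le> real k * ((\<Sum>t<T. ?e t) + (\<Sum>t<T. ?e t))"
    by (intro mult_left_mono) auto
  then show ?thesis using sum_learning_rate_le[of T] by (simp add: algebra_simps)
qed

lemma expert_regret:
  assumes "i \<in> {1..M}"
  shows "(\<Sum>t<T. measure_pmf.expectation (law t) (\<lambda>j. loss (Suc t) j - loss t j))
    \<le> loss T i + 4 * sqrt (real T * real k * ln (real M))"
\<comment> \<open>For \<open>M = 1\<close> the learning rate is 0 and \<open>hedge_regret\<close>
  cannot be used, but the only expert has no regret. The case \<open>T = 0\<close> is split off so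
  that \<open>Suc T \<le> 4 * T\<close> below.\<close>
proof (cases "M = 1 \<or> T = 0")
  case True
  moreover have ?thesis if "M = 1"
  proof -
    have "(\<Sum>t<T. measure_pmf.expectation (law t) (\<lambda>j. loss (Suc t) j - loss t j))
        = (\<Sum>t<T. loss (Suc t) i - loss t i)"
      using that assms by (simp add: expert_dist_def expectation_hedge_pmf)
    also have "\<dots> = loss T i" using sum_lessThan_telescope[of "\<lambda>t. loss t i" T] by simp
    finally show ?thesis using that by simp
  qed
  ultimately show ?thesis by auto
next
  case False
  then have M2: "2 \<le> M" and T: "1 \<le> T" using M by auto
  let ?e = "learning_rate M k"
  have lnM: "0 < ln (real M)" using M2 by simp
  have pos: "0 < ?e t" for t using lnM k by (simp add: learning_rate_def)
  have "(\<Sum>t<T. measure_pmf.expectation (law t) (\<lambda>j. loss (Suc t) j - loss t j))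
      \<le> loss T i + ln (real M) / ?e T + (\<Sum>t<T. ?e t)"
    unfolding expert_dist_def
    by (rule hedge_regret[where e = ?e and L = loss])
      (use M pos learning_rate_antimono[OF M k] assms in \<open>auto simp: expert_loss_Suc\<close>)
  moreover have "ln (real M) / ?e T \<le> 2 * sqrt (real T * real k * ln (real M))"
  proof -
    have "ln (real M) / ?e T = ln (real M) / sqrt (ln (real M)) * sqrt (real k * real (Suc T))"
      by (simp add: learning_rate_def real_sqrt_divide)
    also have "\<dots> = sqrt (real (Suc T) * real k * ln (real M))"
      using lnM by (simp add: real_div_sqrt real_sqrt_mult)
    also have "\<dots> \<le> sqrt (4 * (real T * real k * ln (real M)))"
      unfolding mult.assoc[symmetric] using T lnM
      by (intro real_sqrt_le_mono mult_right_mono) auto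
    also have "\<dots> = 2 * sqrt (real T * real k * ln (real M))"
      by (simp add: real_sqrt_mult)
    finally show ?thesis .
  qed
  moreover have "(\<Sum>t<T. ?e t) \<le> real k * (\<Sum>t<T. ?e t)"
    using k mult_right_mono[of 1 "real k" "\<Sum>t<T. ?e t"] pos
    by (simp add: sum_nonneg less_imp_le)
  ultimately show ?thesis using sum_learning_rate_le[of T] by linarith
qed

text \<open>The potential is nonnegative, so it may be added to the misses. The constant 8 is 4 for
  the regret of Hedge plus 4 for resampling.\<close>

lemma expected_cost_le:
  assumes "i \<in> {1..M}"
  shows "expected_cost follow_alg n k M T C0 \<sigma> p
    \<le> loss T i + 8 * sqrt (real T * real k * ln (real M))"
proof -
  have "expected_cost follow_alg n k M T C0 \<sigma> p
      \<le> measure_pmf.expectation (history T) (cost_potential T)"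
    unfolding expected_cost_def
    by (intro expectation_mono_finite finite_history) (auto simp: cost_potential_def)
  with expectation_cost_potential[of T] expert_regret[OF assms, of T] sum_switch_bound_le[of T]
  show ?thesis by linarith
qed

end

theorem theorem3:
  shows "\<exists>(A :: rand_alg) (c :: real). rand_paging_alg A \<and> c > 0 \<and>
    (\<forall>n k T M C0 \<sigma> p.
       paging_instance n k T C0 \<sigma> \<and> M \<ge> 1 \<and> nat_predictors n T M p \<longrightarrow>
       expected_cost A n k M T C0 \<sigma> p - real (OPT T C0 \<sigma>)
         \<le> c * (real (min_pred_errors T \<sigma> M p) + real k + sqrt (real T * real k * ln (real M))))"
proof (rule exI[of _ follow_alg], rule exI[of _ 8], intro conjI allI impI)
  show "rand_paging_alg follow_alg" by (rule rand_paging_alg_follow_alg)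
  show "(8 :: real) > 0" by simp
  fix n k T M :: nat and C0 :: "page set" and \<sigma> :: "nat \<Rightarrow> page" and p :: "nat \<Rightarrow> nat \<Rightarrow> nat"
  assume "paging_instance n k T C0 \<sigma> \<and> M \<ge> 1 \<and> nat_predictors n T M p"
  then have inst: "paging_instance n k T C0 \<sigma>" and M: "M \<ge> 1" by auto
  interpret followed_experts n k M C0 \<sigma> p
    by standard (use inst M in \<open>auto simp: paging_instance_def finite_subset\<close>)
  have "min_pred_errors T \<sigma> M p \<in> (\<lambda>j. pred_errors T \<sigma> (p j)) ` {1..M}"
    unfolding min_pred_errors_def using M by (intro Min_in) auto
  then obtain i where i: "i \<in> {1..M}" "pred_errors T \<sigma> (p i) = min_pred_errors T \<sigma> M p"
    by auto
  have "C0 \<noteq> {}" using C0 k by auto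
  then obtain C where C: "feasible_schedule T C0 \<sigma> C" "misses T \<sigma> C = OPT T C0 \<sigma>"
    by (rule OPT_attained)
  have "misses T \<sigma> (S i) \<le> OPT T C0 \<sigma> + k + 2 * min_pred_errors T \<sigma> M p"
    using expert_misses_le_feasible[OF inst C(1), of "p i"] C(2) i(2) by simp
  then have "loss T i \<le> real (OPT T C0 \<sigma>) + real k + 2 * real (min_pred_errors T \<sigma> M p)"
    unfolding expert_loss_def by linarith
  \<comment> \<open>The coefficients are 2 for the errors, 1 for \<open>k\<close> and 8 for the
    square root, so 8 covers all three.\<close>
  with expected_cost_le[OF i(1), of T]
  show "expected_cost follow_alg n k M T C0 \<sigma> p - real (OPT T C0 \<sigma>)
      \<le> 8 * (real (min_pred_errors T \<sigma> M p) + real k + sqrt (real T * real k * ln (real M)))"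
    by simp
qed

end
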